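(* Let $m>1$. For every positive integer $k$ there exists $\delta_k>0$ such that for every $\sigma\in(0,\delta_k)$ there exist at least $k$ different good profiles with interface to the equation $$(f^m)''(\xi)-\frac{1}{m-1}f(\xi)+\xi^{\sigma}f^{m}(\xi)=0,\qquad \xi\in[0,\infty).$$ All these profiles satisfy property (P1), and there is no good profile with interface satisfying property (P2).
   Context: A solution (profile) $f$ of the equation on an interval $I\subset[0,\infty)$ is a nonnegative continuous function on $I$ with $f^m\in C^2(I)$ satisfying the equation on $I$. (If $f$ solves the equation on $[0,\infty)$, then $u(x,t)=(T-t)^{-1/(m-1)}f(|x|)$ is a self-similar blow up solution of $u_t=(u^m)_{xx}+|x|^\sigma u^m$.) A solution $f$ of the equation is a good profile if it fulfills one of the following two properties: (P1) $f(0)=a>0$ and $f'(0)=0$; (P2) $f(0)=0$ and $(f^m)'(0)=0$. A good profile $f$ is a good profile with interface at some point $\eta\in(0,\infty)$ if $f(\eta)=0$, $(f^m)'(\eta)=0$ and $f>0$ on $(\eta-\delta,\eta)$ for some $\delta>0$. A good profile with interface is a good profile that has an interface at some $\eta\in(0,\infty)$; profiles with interface at $\eta$ which are positive before $\eta$ are understood as extended by $0$ for $\xi>\eta$. *)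

theory Defs
  imports Complex_Main
begin

text \<open>Derivatives are relative to \<open>I\<close>, hence one-sided at an endpoint of the interval \<open>I\<close> that
  belongs to it.\<close>

definition C2_on :: "real set \<Rightarrow> (real \<Rightarrow> real) \<Rightarrow> (real \<Rightarrow> real) \<Rightarrow> (real \<Rightarrow> real) \<Rightarrow> bool" where
  "C2_on I g g' g'' \<longleftrightarrow>
     (\<forall>\<xi>\<in>I. (g has_real_derivative g' \<xi>) (at \<xi> within I)) \<and>
     (\<forall>\<xi>\<in>I. (g' has_real_derivative g'' \<xi>) (at \<xi> within I)) \<and>
     continuous_on I g''"

definition solution_on :: "real \<Rightarrow> real \<Rightarrow> real set \<Rightarrow> (real \<Rightarrow> real) \<Rightarrow> bool" where
  "solution_on m \<sigma> I f \<longleftrightarrow>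
     continuous_on I f \<and> (\<forall>\<xi>\<in>I. 0 \<le> f \<xi>) \<and>
     (\<exists>g' g''. C2_on I (\<lambda>\<xi>. f \<xi> powr m) g' g'' \<and>
        (\<forall>\<xi>\<in>I. g'' \<xi> - 1 / (m - 1) * f \<xi> + \<xi> powr \<sigma> * f \<xi> powr m = 0))"

definition P1 :: "(real \<Rightarrow> real) \<Rightarrow> bool" where
  "P1 f \<longleftrightarrow> f 0 > 0 \<and> (f has_real_derivative 0) (at 0 within {0..})"

definition P2 :: "real \<Rightarrow> (real \<Rightarrow> real) \<Rightarrow> bool" where
  "P2 m f \<longleftrightarrow> f 0 = 0 \<and> ((\<lambda>\<xi>. f \<xi> powr m) has_real_derivative 0) (at 0 within {0..})"

definition good_profile :: "real \<Rightarrow> real \<Rightarrow> (real \<Rightarrow> real) \<Rightarrow> bool" where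
  "good_profile m \<sigma> f \<longleftrightarrow> solution_on m \<sigma> {0..} f \<and> (P1 f \<or> P2 m f)"

text \<open>The last conjunct is the convention that a profile which is positive before its interface is
  extended by zero beyond it. It does not restrict profiles satisfying \<^const>\<open>P2\<close>, since these
  vanish at \<open>0\<close>.\<close>

definition good_profile_with_interface_at ::
    "real \<Rightarrow> real \<Rightarrow> real \<Rightarrow> (real \<Rightarrow> real) \<Rightarrow> bool" where
  "good_profile_with_interface_at m \<sigma> \<eta> f \<longleftrightarrow>
     good_profile m \<sigma> f \<and> 0 < \<eta> \<and>
     f \<eta> = 0 \<and> ((\<lambda>\<xi>. f \<xi> powr m) has_real_derivative 0) (at \<eta>) \<and>
     (\<exists>\<delta>>0. \<delta> \<le> \<eta> \<and> (\<forall>\<xi>\<in>{\<eta> - \<delta><..<\<eta>}. 0 < f \<xi>)) \<and>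
     ((\<forall>\<xi>\<in>{0..<\<eta>}. 0 < f \<xi>) \<longrightarrow> (\<forall>\<xi>>\<eta>. f \<xi> = 0))"

definition good_profile_with_interface :: "real \<Rightarrow> real \<Rightarrow> (real \<Rightarrow> real) \<Rightarrow> bool" where
  "good_profile_with_interface m \<sigma> f \<longleftrightarrow> (\<exists>\<eta>. good_profile_with_interface_at m \<sigma> \<eta> f)"

text \<open>Profiles are functions on \<open>[0,\<infinity>)\<close>; the values of their representatives at negative
  arguments are immaterial and must not make two profiles different.\<close>

definition different_profiles :: "(real \<Rightarrow> real) \<Rightarrow> (real \<Rightarrow> real) \<Rightarrow> bool" where
  "different_profiles f g \<longleftrightarrow> (\<exists>\<xi>\<ge>0. f \<xi> \<noteq> g \<xi>)"

end

theory Submission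
  imports Defs "HOL-Complex_Analysis.Great_Picard"
begin

text \<open>Put \<open>p = 1 / m\<close>. A multiple \<open>x\<close> of \<open>f powr m\<close> solves \<open>x'' = x powr p - \<xi> powr \<sigma> * x\<close>, and
  the energy \<open>x'\<^sup>2 / 2 - x powr (p + 1) / (p + 1) + \<xi> powr \<sigma> * x\<^sup>2 / 2\<close> is nondecreasing in \<open>\<xi>\<close>. It vanishes
  at an interface, and it vanishes at \<open>0\<close> under (P2); hence a (P2) profile is zero up to
  its interface.

  For existence, shoot backwards from the interface \<open>\<eta>\<close>. Going backwards the energy becomes negative,
  so the orbit stays positive and reaches \<open>\<xi> = 0\<close>; it is a profile iff \<open>x' = 0\<close> there. For small
  \<open>\<sigma>\<close> the autonomous energy (\<open>\<sigma> = 0\<close>) is almost conserved on a long interval \<open>[0, R]\<close>, so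
  \<open>(x, x')\<close> keeps away from the equilibrium \<open>(1, 0)\<close> and turns around it at least \<open>k\<close> half turns
  when \<open>\<eta> = R\<close>. The angle swept depends continuously on \<open>\<eta>\<close> and is \<open>0\<close> for \<open>\<eta> = 0\<close>, so it takes
  each of the values \<open>- j * pi\<close>, \<open>1 \<le> j \<le> k\<close>; these give \<open>x' = 0\<close> at \<open>\<xi> = 0\<close>, and the angle
  distinguishes the profiles.

  As \<open>x powr p\<close> is not Lipschitz at \<open>0\<close>, the orbits are started at \<open>(\<epsilon>, 0)\<close>, where the energy is
  already negative, and \<open>\<epsilon> \<rightarrow> 0\<close> by Arzela-Ascoli. Backward time is normalised to
  \<open>t = 1 - \<xi> / \<eta> \<in> [0, 1]\<close>.\<close>

section \<open>Initial value problems depending on a parameter\<close>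

text \<open>The obstacle is uniformity as \<epsilon> tends to 0. Orbits with a small start may
  linger near height 0, where the angle hardly changes, so neither the number of turns nor the
  nontriviality of the limit is automatic. Both follow from the quantity
  \<open>v / h powr p\<close>: nonpositive energy bounds \<open>v\<^sup>2\<close> by a multiple of
  \<open>h powr (p + 1)\<close>, and this forces a growth of that quantity, at low heights, at a
  rate that does not depend on \<epsilon>. One consequence is a bound for the angle that decreases
  linearly in \<eta>; the other is a quadratic lower bound for \<open>h powr (1 - p)\<close> that
  survives the limit.

  The angle is not a lift of polar coordinates but the integral of the angular velocity. Its
  continuity in \<eta> and its passage to the limit thus concern integrals over a fixed interval,
  with a denominator bounded away from 0.

  The constants are chosen in the order \<open>C\<close> (from p), \<open>R\<close> (from p,
  \<open>C\<close> and k), a bound for \<sigma>, and \<epsilon> last. In particular \<open>C\<close>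
  must not depend on \<open>R\<close>, and one bound for \<sigma> serves all k angles.\<close>

lemma integral_clipped_kernel:
  fixes k :: "real \<Rightarrow> real"
  assumes k: "continuous_on {0..1} k" and \<tau>: "\<tau> \<in> {0..1}"
  shows "integral {0..1} (\<lambda>t. max (\<tau> - t) 0 * k t)
    = \<tau> * integral {0..\<tau>} k - integral {0..\<tau>} (\<lambda>t. t * k t)"
proof -
  have ck: "continuous_on {0..\<tau>} k" by (rule continuous_on_subset[OF k]) (use \<tau> in auto)
  have "integral {0..1} (\<lambda>t. max (\<tau> - t) 0 * k t)
    = integral {0..\<tau>} (\<lambda>t. max (\<tau> - t) 0 * k t) + integral {\<tau>..1} (\<lambda>t. max (\<tau> - t) 0 * k t)"
    using \<tau> by (intro Henstock_Kurzweil_Integration.integral_combine[symmetric] integrable_continuous_real continuous_intros k) auto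
  also have "integral {\<tau>..1} (\<lambda>t. max (\<tau> - t) 0 * k t) = integral {\<tau>..1} (\<lambda>t. 0)"
    by (rule integral_cong) auto
  also have "integral {0..\<tau>} (\<lambda>t. max (\<tau> - t) 0 * k t) = integral {0..\<tau>} (\<lambda>t. \<tau> * k t - t * k t)"
    by (rule integral_cong) (auto simp: algebra_simps)
  also have "\<dots> = integral {0..\<tau>} (\<lambda>t. \<tau> * k t) - integral {0..\<tau>} (\<lambda>t. t * k t)"
    by (intro integral_diff integrable_continuous_real continuous_intros ck)
  finally show ?thesis by simp
qed

text \<open>Substitution moves the upper limit \<tau> into the integrand; joint continuity in \<tau>
  and a further parameter can then be read off from a parameter integral over a fixed
  interval.\<close>

lemma integral_rescale_unit:
  fixes k :: "real \<Rightarrow> real"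
  assumes k: "continuous_on {0..1} k" and \<tau>: "\<tau> \<in> {0..1}"
  shows "\<tau> * integral {0..1} (\<lambda>r. k (\<tau> * r)) = integral {0..\<tau>} k"
proof (cases "\<tau> = 0")
  case False
  have ck: "continuous_on {0..\<tau>} k" by (rule continuous_on_subset[OF k]) (use \<tau> in auto)
  have "((\<lambda>r. k (\<tau> * r)) has_integral (1 / \<bar>\<tau>\<bar>) * integral {0..\<tau>} k) ((\<lambda>x. x / \<tau>) ` {0..\<tau>})"
    using has_integral_stretch_real[OF integrable_integral[OF integrable_continuous_real[OF ck]] False]
    by simp
  moreover have "(\<lambda>x. x / \<tau>) ` {0..\<tau>} = {0..1}"
    using False \<tau> by (auto simp: image_iff divide_simps intro!: bexI[of _ "_ * \<tau>"] mult_left_le_one_le)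
  ultimately show ?thesis using False \<tau> by (simp add: integral_unique)
qed simp

text \<open>From \<open>exp y \<ge> y\<close>. This is the source of the contraction: under the
  exponential weight the kernel \<tau> - t costs only a factor 1 / L.\<close>

lemma exp_kernel_le:
  fixes L x :: real
  assumes "L > 0"
  shows "exp (- L * x) * max x 0 \<le> 1 / L"
proof (cases "x > 0")
  case True
  have "L * x \<le> exp (L * x)" using exp_ge_add_one_self[of "L * x"] by linarith
  then show ?thesis using assms True by (simp add: field_simps exp_minus)
next
  case False
  then show ?thesis using assms by (simp add: max_def)
qed

text \<open>Working with functions of both the parameter and the time makes the fixed point jointly
  continuous at once; the clipped kernel keeps the domain of integration independent of \<open>\<tau>\<close>, and the
  weight \<open>exp (- L * \<tau>)\<close> in the proof turns the integral operator into a contraction.\<close>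

lemma integral_equation_param:
  fixes G :: "real \<Rightarrow> real \<Rightarrow> real \<Rightarrow> real" and a R \<Lambda> :: real
  assumes R: "0 \<le> R" and \<Lambda>: "0 \<le> \<Lambda>"
    and cont: "continuous_on UNIV (\<lambda>z. G (fst z) (fst (snd z)) (snd (snd z)))"
    and lip: "\<And>\<eta> t x y. \<bar>G \<eta> t x - G \<eta> t y\<bar> \<le> \<Lambda> * \<bar>x - y\<bar>"
  obtains h where "continuous_on UNIV (\<lambda>z. h (fst z) (snd z))"
    "\<And>\<eta> \<tau>. \<eta> \<in> {0..R} \<Longrightarrow> \<tau> \<in> {0..1} \<Longrightarrow>
       h \<eta> \<tau> = a + \<eta>\<^sup>2 * integral {0..1} (\<lambda>t. max (\<tau> - t) 0 * G \<eta> t (h \<eta> t))"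
proof -
  define L where "L = 2 * R\<^sup>2 * \<Lambda> + 1"
  \<comment> \<open>The factor 2 in \<open>L\<close> makes the contraction constant
    \<open>R\<^sup>2 * \<Lambda> / L\<close> at most 1/2; the summand 1 keeps \<open>L\<close>
    positive when \<open>R\<close> or \<Lambda> is 0.\<close>
  have L: "L > 0" unfolding L_def using \<Lambda> by (intro add_nonneg_pos mult_nonneg_nonneg) auto
  \<comment> \<open>Retraction onto the rectangle of parameters and times. Composed with it, a
    continuous function becomes bounded and continuous on the whole plane, which is the complete
    space for the fixed point.\<close>
  define cl where "cl = (\<lambda>z::real\<times>real. (max 0 (min R (fst z)), max 0 (min 1 (snd z))))"
  have cl_mem: "cl z \<in> {0..R} \<times> {0..1}" for z using R by (auto simp: cl_def)
  have cl_id: "cl z = z" if "z \<in> {0..R} \<times> {0..1}" for z using that by (auto simp: cl_def)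
  have cl_cont: "continuous_on UNIV cl" unfolding cl_def by (intro continuous_intros)
  \<comment> \<open>The unknown is \<open>w = exp (- L * \<tau>) * h\<close>, hence the factor
    \<open>exp (L * t)\<close> inside \<open>G\<close>.\<close>
  define kern where "kern = (\<lambda>(w::(real\<times>real) \<Rightarrow>\<^sub>C real) (z::real\<times>real) (t::real).
     exp (- L * snd z) * max (snd z - t) 0 * G (fst z) t (exp (L * t) * apply_bcontfun w (fst z, t)))"
  define K where "K = (\<lambda>w z. exp (- L * snd z) * a + (fst z)\<^sup>2 * integral {0..1} (kern w z))"
  have G_comp: "continuous_on S (\<lambda>u. G (p u) (q u) (r u))"
    if "continuous_on S p" "continuous_on S q" "continuous_on S r" for S :: "((real\<times>real)\<times>real) set" and p q r
    using continuous_on_compose2[OF cont, of S "\<lambda>u. (p u, q u, r u)"] that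
    by (simp add: continuous_on_Pair)
  have w_comp: "continuous_on S (\<lambda>u. apply_bcontfun w (p u))"
    if "continuous_on S p" for S :: "((real\<times>real)\<times>real) set" and p and w :: "(real\<times>real) \<Rightarrow>\<^sub>C real"
    by (rule continuous_on_compose2[OF continuous_on_apply_bcontfun that]) auto
  have kern_cont: "continuous_on UNIV (\<lambda>(z,t). kern w z t)" for w
    unfolding kern_def split_beta by (intro continuous_intros G_comp w_comp)
  have kern_cont1: "continuous_on {0..1} (kern w z)" for w z
  proof -
    have "continuous_on {0..1} (\<lambda>t. (z, t))" by (rule continuous_on_Pair) (rule continuous_on_const continuous_on_id)+
    from continuous_on_compose2[OF kern_cont[of w] this] show ?thesis by simp
  qed
  have K_cont: "continuous_on UNIV (K w)" for w
  proof -
    have "continuous_on UNIV (\<lambda>z. integral (cbox 0 1) (kern w z))"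
      by (rule integral_continuous_on_param, rule continuous_on_subset[OF kern_cont]) auto
    then show ?thesis unfolding K_def cbox_interval by (intro continuous_intros)
  qed
  have K_bc: "(\<lambda>z. K w (cl z)) \<in> bcontfun" for w
  proof -
    have "continuous_on UNIV (\<lambda>z. K w (cl z))"
      by (rule continuous_on_compose2[OF K_cont cl_cont]) auto
    moreover have "compact (K w ` ({0..R} \<times> {0..1}))"
      by (intro compact_continuous_image continuous_on_subset[OF K_cont] compact_Times) auto
    then have "bounded (range (\<lambda>z. K w (cl z)))"
      by (rule bounded_subset[OF compact_imp_bounded]) (use cl_mem in auto)
    ultimately show ?thesis by (simp add: bcontfun_def)
  qed
  define T where "T w = Bcontfun (\<lambda>z. K w (cl z))" for w
  have T_app: "apply_bcontfun (T w) z = K w (cl z)" for w z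
    using K_bc by (simp add: T_def Bcontfun_inverse)
  have K_diff: "\<bar>K w z - K w' z\<bar> \<le> 1/2 * dist w w'" if z: "z \<in> {0..R} \<times> {0..1}" for w w' z
  proof -
    have pt: "\<bar>kern w z t - kern w' z t\<bar> \<le> \<Lambda> * dist w w' / L" for t
    proof -
      have "\<bar>kern w z t - kern w' z t\<bar> = exp (- L * snd z) * max (snd z - t) 0 *
          \<bar>G (fst z) t (exp (L * t) * apply_bcontfun w (fst z, t)) - G (fst z) t (exp (L * t) * apply_bcontfun w' (fst z, t))\<bar>"
        by (simp add: kern_def abs_mult right_diff_distrib[symmetric])
      also have "\<dots> \<le> exp (- L * snd z) * max (snd z - t) 0 *
          (\<Lambda> * \<bar>exp (L * t) * apply_bcontfun w (fst z, t) - exp (L * t) * apply_bcontfun w' (fst z, t)\<bar>)"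
        by (intro mult_left_mono lip) auto
      also have "\<dots> = \<Lambda> * (exp (- L * (snd z - t)) * max (snd z - t) 0) * \<bar>apply_bcontfun w (fst z, t) - apply_bcontfun w' (fst z, t)\<bar>"
      proof -
        have e1: "exp (- L * (snd z - t)) = exp (- L * snd z) * exp (L * t)"
          unfolding exp_add[symmetric] by (simp add: right_diff_distrib)
        have e2: "\<bar>exp (L * t) * x - exp (L * t) * y\<bar> = exp (L * t) * \<bar>x - y\<bar>" for x y :: real
          by (simp add: abs_mult right_diff_distrib[symmetric])
        show ?thesis unfolding e1 e2 by (simp only: mult_ac)
      qed
      also have "\<dots> \<le> \<Lambda> * (1 / L) * dist w w'"
        using dist_bounded[of w "(fst z, t)" w'] exp_kernel_le[OF L, of "snd z - t"] L \<Lambda>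
        by (intro mult_mono) (auto simp: dist_real_def)
      finally show ?thesis by simp
    qed
    have "K w z - K w' z = (fst z)\<^sup>2 * integral {0..1} (\<lambda>t. kern w z t - kern w' z t)"
      unfolding K_def by (subst Henstock_Kurzweil_Integration.integral_diff) 
        (auto intro!: integrable_continuous_real kern_cont1 simp: algebra_simps)
    then have "\<bar>K w z - K w' z\<bar> = (fst z)\<^sup>2 * \<bar>integral {0..1} (\<lambda>t. kern w z t - kern w' z t)\<bar>"
      by (simp add: abs_mult)
    also have "\<dots> \<le> R\<^sup>2 * (\<Lambda> * dist w w' / L)"
    proof (intro mult_mono)
      show "(fst z)\<^sup>2 \<le> R\<^sup>2" using z by (intro power_mono) auto
      have "norm (integral {0..1} (\<lambda>t. kern w z t - kern w' z t)) \<le> \<Lambda> * dist w w' / L * (1 - 0)"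
        by (rule integral_bound) (use pt in \<open>auto intro!: continuous_intros kern_cont1\<close>)
      then show "\<bar>integral {0..1} (\<lambda>t. kern w z t - kern w' z t)\<bar> \<le> \<Lambda> * dist w w' / L" by simp
    qed (use L \<Lambda> in auto)
    also have "\<dots> = (R\<^sup>2 * \<Lambda> / L) * dist w w'" by simp
    also have "\<dots> \<le> 1/2 * dist w w'"
      using L by (intro mult_right_mono) (auto simp: L_def field_simps)
    finally show ?thesis .
  qed
  have "\<exists>!w. T w = w"
  proof (rule banach_fix_type[of "1/2"])
    show "\<forall>w w'. dist (T w) (T w') \<le> 1/2 * dist w w'"
      by (intro allI dist_bound) (simp only: T_app dist_real_def K_diff[OF cl_mem])
  qed auto
  then obtain w where w: "T w = w" by blast
  have weq: "apply_bcontfun w z = K w z" if "z \<in> {0..R} \<times> {0..1}" for z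
    using T_app[of w z] w cl_id[OF that] by simp
  define h where "h \<eta> t = exp (L * t) * apply_bcontfun w (\<eta>, t)" for \<eta> t
  show ?thesis
  proof
    show "continuous_on UNIV (\<lambda>z. h (fst z) (snd z))"
      unfolding h_def by (auto intro!: continuous_intros)
    fix \<eta> \<tau> :: real assume A: "\<eta> \<in> {0..R}" "\<tau> \<in> {0..1}"
    have "integral {0..1} (kern w (\<eta>, \<tau>)) = integral {0..1} (\<lambda>t. exp (- L * \<tau>) * (max (\<tau> - t) 0 * G \<eta> t (h \<eta> t)))"
      by (rule integral_cong) (auto simp: kern_def h_def)
    also have "\<dots> = exp (- L * \<tau>) * integral {0..1} (\<lambda>t. max (\<tau> - t) 0 * G \<eta> t (h \<eta> t))" by simp
    finally have "integral {0..1} (kern w (\<eta>, \<tau>)) = exp (- L * \<tau>) * integral {0..1} (\<lambda>t. max (\<tau> - t) 0 * G \<eta> t (h \<eta> t))" .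
    then have "apply_bcontfun w (\<eta>, \<tau>) = exp (- L * \<tau>) * (a + \<eta>\<^sup>2 * integral {0..1} (\<lambda>t. max (\<tau> - t) 0 * G \<eta> t (h \<eta> t)))"
      using weq[of "(\<eta>, \<tau>)"] A by (simp add: K_def algebra_simps)
    then show "h \<eta> \<tau> = a + \<eta>\<^sup>2 * integral {0..1} (\<lambda>t. max (\<tau> - t) 0 * G \<eta> t (h \<eta> t))"
      by (simp add: h_def[of \<eta> \<tau>] exp_minus)
  qed
qed

text \<open>Integrating the equation twice from v = 0 gives the integral equation with kernel \<tau>
  - t. Joint continuity is recorded because the angle must depend continuously on \<eta>.\<close>

lemma second_order_ivp_param:
  fixes G :: "real \<Rightarrow> real \<Rightarrow> real \<Rightarrow> real" and a R \<Lambda> :: real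
  assumes R: "0 \<le> R" and \<Lambda>: "0 \<le> \<Lambda>"
    and cont: "continuous_on UNIV (\<lambda>z. G (fst z) (fst (snd z)) (snd (snd z)))"
    and lip: "\<And>\<eta> t x y. \<bar>G \<eta> t x - G \<eta> t y\<bar> \<le> \<Lambda> * \<bar>x - y\<bar>"
  obtains h v where
    "continuous_on ({0..R} \<times> {0..1}) (\<lambda>z. h (fst z) (snd z))"
    "continuous_on ({0..R} \<times> {0..1}) (\<lambda>z. v (fst z) (snd z))"
    "\<And>\<eta>. \<eta> \<in> {0..R} \<Longrightarrow> h \<eta> 0 = a" "\<And>\<eta>. \<eta> \<in> {0..R} \<Longrightarrow> v \<eta> 0 = 0"
    "\<And>\<eta> \<tau>. \<eta> \<in> {0..R} \<Longrightarrow> \<tau> \<in> {0..1} \<Longrightarrow> (h \<eta> has_real_derivative \<eta> * v \<eta> \<tau>) (at \<tau> within {0..1})"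
    "\<And>\<eta> \<tau>. \<eta> \<in> {0..R} \<Longrightarrow> \<tau> \<in> {0..1} \<Longrightarrow>
       (v \<eta> has_real_derivative \<eta> * G \<eta> \<tau> (h \<eta> \<tau>)) (at \<tau> within {0..1})"
proof -
  obtain h0 where h0: "continuous_on UNIV (\<lambda>z. h0 (fst z) (snd z))"
    and h0_eq: "\<And>\<eta> \<tau>. \<eta> \<in> {0..R} \<Longrightarrow> \<tau> \<in> {0..1} \<Longrightarrow>
       h0 \<eta> \<tau> = a + \<eta>\<^sup>2 * integral {0..1} (\<lambda>t. max (\<tau> - t) 0 * G \<eta> t (h0 \<eta> t))"
    using integral_equation_param[OF assms] by blast
  define k where "k \<eta> t = G \<eta> t (h0 \<eta> t)" for \<eta> t
  have kc: "continuous_on UNIV (\<lambda>z. k (fst z) (snd z))"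
    unfolding k_def
    using continuous_on_compose2[OF cont, of UNIV "\<lambda>z. (fst z, snd z, h0 (fst z) (snd z))"] h0
    by (simp add: continuous_on_Pair continuous_on_fst continuous_on_snd continuous_on_id)
  have kc1: "continuous_on S (k \<eta>)" for S \<eta>
  proof -
    have "continuous_on S (\<lambda>t. (\<eta>, t))" by (rule continuous_on_Pair) (rule continuous_on_const continuous_on_id)+
    from continuous_on_compose2[OF kc this] show ?thesis by simp
  qed
  \<comment> \<open>The rescaled form gives joint continuity, the form in \<open>v_eq\<close> gives
    the derivative.\<close>
  define v where "v \<eta> \<tau> = \<eta> * (\<tau> * integral {0..1} (\<lambda>r. k \<eta> (\<tau> * r)))" for \<eta> \<tau>
  have v_eq: "v \<eta> \<tau> = \<eta> * integral {0..\<tau>} (k \<eta>)" if "\<tau> \<in> {0..1}" for \<eta> \<tau>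
    using integral_rescale_unit[OF kc1 that] by (simp add: v_def)
  \<comment> \<open>With variable upper limits the product rule applies; the two terms
    \<open>\<tau> * k \<eta> \<tau>\<close> cancel and \<open>\<eta> * v \<eta> \<tau>\<close>
    remains.\<close>
  have h_eq: "h0 \<eta> \<tau> = a + \<eta>\<^sup>2 * (\<tau> * integral {0..\<tau>} (k \<eta>) - integral {0..\<tau>} (\<lambda>t. t * k \<eta> t))"
    if "\<eta> \<in> {0..R}" "\<tau> \<in> {0..1}" for \<eta> \<tau>
    using h0_eq[OF that] integral_clipped_kernel[OF kc1 that(2), of \<eta>] by (simp add: k_def)
  have dI: "((\<lambda>\<tau>. integral {0..\<tau>} (k \<eta>)) has_real_derivative k \<eta> \<tau>) (at \<tau> within {0..1})"
    if "\<tau> \<in> {0..1}" for \<eta> \<tau> by (rule integral_has_real_derivative[OF kc1 that])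
  have dJ: "((\<lambda>\<tau>. integral {0..\<tau>} (\<lambda>t. t * k \<eta> t)) has_real_derivative \<tau> * k \<eta> \<tau>) (at \<tau> within {0..1})"
    if "\<tau> \<in> {0..1}" for \<eta> \<tau> by (rule integral_has_real_derivative[OF _ that]) (intro continuous_intros kc1)
  show ?thesis
  proof (rule that[of h0 v])
    show "continuous_on ({0..R} \<times> {0..1}) (\<lambda>z. h0 (fst z) (snd z))"
      by (rule continuous_on_subset[OF h0]) auto
    have "continuous_on UNIV (\<lambda>z. integral (cbox 0 1) (\<lambda>r. k (fst z) (snd z * r)))"
    proof (rule integral_continuous_on_param)
      have "continuous_on (UNIV \<times> cbox 0 1) (\<lambda>u::(real \<times> real) \<times> real. (fst (fst u), snd (fst u) * snd u))"
        by (intro continuous_intros)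
      from continuous_on_compose2[OF kc this]
      show "continuous_on (UNIV \<times> cbox 0 1) (\<lambda>(z, r). k (fst z) (snd z * r))"
        by (simp add: split_beta)
    qed
    then have "continuous_on UNIV (\<lambda>z. v (fst z) (snd z))"
      unfolding v_def cbox_interval by (intro continuous_intros)
    then show "continuous_on ({0..R} \<times> {0..1}) (\<lambda>z. v (fst z) (snd z))"
      by (rule continuous_on_subset) auto
    fix \<eta> assume \<eta>: "\<eta> \<in> {0..R}"
    show "h0 \<eta> 0 = a" using h_eq[OF \<eta>, of 0] by simp
    show "v \<eta> 0 = 0" by (simp add: v_def)
    fix \<tau> :: real assume \<tau>: "\<tau> \<in> {0..1}"
    have "((\<lambda>\<tau>. a + \<eta>\<^sup>2 * (\<tau> * integral {0..\<tau>} (k \<eta>) - integral {0..\<tau>} (\<lambda>t. t * k \<eta> t)))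
        has_real_derivative \<eta> * v \<eta> \<tau>) (at \<tau> within {0..1})"
      by (rule derivative_eq_intros dI[OF \<tau>] dJ[OF \<tau>] refl)+ (simp add: v_eq[OF \<tau>] power2_eq_square)
    then show "(h0 \<eta> has_real_derivative \<eta> * v \<eta> \<tau>) (at \<tau> within {0..1})"
      by (rule has_field_derivative_transform_within[OF _ zero_less_one \<tau>]) (simp add: h_eq[OF \<eta>])
    have "((\<lambda>\<tau>. \<eta> * integral {0..\<tau>} (k \<eta>)) has_real_derivative \<eta> * G \<eta> \<tau> (h0 \<eta> \<tau>)) (at \<tau> within {0..1})"
      by (rule derivative_eq_intros dI[OF \<tau>] refl)+ (simp add: k_def)
    then show "(v \<eta> has_real_derivative \<eta> * G \<eta> \<tau> (h0 \<eta> \<tau>)) (at \<tau> within {0..1})"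
      by (rule has_field_derivative_transform_within[OF _ zero_less_one \<tau>]) (simp add: v_eq)
  qed
qed

section \<open>Energy\<close>

text \<open>The weight \<open>W\<close> is \<open>\<xi> powr \<sigma>\<close> for the monotone energy and \<open>1\<close> for the almost conserved one.\<close>

definition energy :: "real \<Rightarrow> real \<Rightarrow> real \<Rightarrow> real \<Rightarrow> real" where
  "energy p W x y = y\<^sup>2 / 2 - x powr (p + 1) / (p + 1) + W * x\<^sup>2 / 2"

text \<open>Minus the energy (\<open>W = 1\<close>) of the equilibrium \<open>(1, 0)\<close>.\<close>

definition energy_gap :: "real \<Rightarrow> real" where
  "energy_gap p = (1 - p) / (2 * (1 + p))"

section \<open>Convexity inequalities for the force and the potential\<close>

lemma powr_le_linear:
  fixes x q :: real
  assumes "0 < x" "0 < q" "q < 1"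
  shows "x powr q \<le> 1 + q * (x - 1)"
  using Youngs_inequality_0[of q "1 - q" x 1] assms by (simp add: algebra_simps)

lemma powr_mult_complement:
  fixes x p :: real
  assumes "0 < x" shows "x powr p * x powr (1 - p) = x"
  using assms by (simp flip: powr_add)

text \<open>For \<open>x \<ge> 1\<close> the tangent of \<open>x powr p\<close> at 1 gives the
  factor 1 - p. For x < 1 one splits off \<open>x powr p\<close> and uses the tangent of
  \<open>x powr (1 - p)\<close>; the factor split off is where \<open>h0\<close> enters. With
  \<open>h0 = 0\<close> only the sign of the force is left.\<close>

lemma restoring_force_ge:
  fixes x p h0 :: real
  assumes p: "0 < p" "p < 1" and h0: "0 \<le> h0" "h0 \<le> 1" and x: "0 < x" "h0 \<le> x"
  shows "(x - 1) * (x - x powr p) \<ge> (1 - p) * h0 powr p * (x - 1)\<^sup>2"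
proof (cases "x \<ge> 1")
  case True
  have "h0 powr p \<le> 1 powr p" by (rule powr_mono2) (use p h0 in auto)
  then have "(1 - p) * h0 powr p * (x - 1) \<le> (1 - p) * 1 * (x - 1)"
    using True p by (intro mult_right_mono mult_left_mono) auto
  also have "\<dots> \<le> x - x powr p" using powr_le_linear[of x p] p x by (simp add: algebra_simps)
  finally have "(x - 1) * ((1 - p) * h0 powr p * (x - 1)) \<le> (x - 1) * (x - x powr p)"
    using True by (intro mult_left_mono) auto
  then show ?thesis by (simp add: power2_eq_square mult_ac)
next
  case False
  have "(1 - p) * h0 powr p * (1 - x) \<le> (1 - p) * x powr p * (1 - x)"
    using False p h0 x by (intro mult_right_mono mult_left_mono powr_mono2) auto
  also have "\<dots> = x powr p * ((1 - p) * (1 - x))" by simp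
  also have "\<dots> \<le> x powr p * (1 - x powr (1 - p))"
    using powr_le_linear[of x "1 - p"] p x by (intro mult_left_mono) (auto simp: algebra_simps)
  also have "\<dots> = x powr p - x" using powr_mult_complement[of x p] x by (simp add: right_diff_distrib)
  finally have "(1 - x) * ((1 - p) * h0 powr p * (1 - x)) \<le> (1 - x) * (x powr p - x)"
    using False by (intro mult_left_mono) auto
  then show ?thesis by (simp add: power2_eq_square algebra_simps)
qed

lemma restoring_force_nonneg:
  fixes x p :: real
  assumes "0 < p" "p < 1" "0 < x"
  shows "(x - 1) * (x - x powr p) \<ge> 0"
  using restoring_force_ge[of p 0 x] assms by simp

text \<open>The convex function \<open>x powr (p + 1) / (p + 1)\<close> lies above its tangent at 1;
  replacing it by the tangent turns the energy above its minimum into half the squared distance to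
  (1, 0).\<close>

lemma dist_equilibrium_ge_energy:
  fixes x y p :: real
  assumes p: "0 < p" "p < 1" and x: "0 \<le> x"
  shows "2 * (energy p 1 x y + energy_gap p) \<le> (x - 1)\<^sup>2 + y\<^sup>2"
proof -
  have "(p + 1) * x \<le> x powr (p + 1) + p"
  proof (cases "x = 0")
    case False
    \<comment> \<open>Bernoulli's inequality for the exponent p + 1, read off from the concave
      exponent 1 / (p + 1).\<close>
    have "(x powr (p + 1)) powr (1 / (p + 1)) \<le> 1 + 1 / (p + 1) * (x powr (p + 1) - 1)"
      by (rule powr_le_linear) (use False x p in auto)
    also have "(x powr (p + 1)) powr (1 / (p + 1)) = x" using False x p by (simp add: powr_powr)
    finally show ?thesis using p by (simp add: field_simps)
  qed (use p in auto)
  then have "x \<le> (x powr (p + 1) + p) / (p + 1)" using p by (simp add: pos_le_divide_eq mult.commute)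
  then have "x \<le> x powr (p + 1) / (p + 1) + p / (p + 1)" by (simp add: add_divide_distrib)
  moreover have "energy_gap p = 1/2 - p / (p + 1)" using p by (simp add: energy_gap_def field_simps)
  moreover have "2 * (y\<^sup>2 / 2 - a + 1 * x\<^sup>2 / 2 + g) \<le> x\<^sup>2 + 1 - 2 * x * 1 + y\<^sup>2"
    if "x \<le> a + b" "g = 1/2 - b" for a b g using that by (simp add: field_simps)
  ultimately show ?thesis unfolding energy_def power2_diff one_power2 by blast
qed

text \<open>As p + 1 < 2, the power is absorbed by half of the \<open>x\<^sup>2 / 2\<close> in the
  energy, so energy plus \<open>C\<close> controls both coordinates. The lower bound
  \<open>A\<close> is there to get \<open>C\<close> above \<open>energy_gap p\<close>.\<close>

lemma ex_subquadratic_bound: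
  fixes p A :: real
  assumes p: "0 < p" "p < 1"
  obtains C where "C \<ge> A" "\<And>x. x \<ge> 0 \<Longrightarrow> x powr (p + 1) / (p + 1) \<le> x\<^sup>2 / 4 + C"
proof -
  \<comment> \<open>Beyond \<open>Y\<close> the quotient of \<open>x\<^sup>2\<close> and
    \<open>x powr (p + 1)\<close> is at least 4.\<close>
  define Y where "Y = 4 powr (1 / (1 - p))"
  show ?thesis
  proof (rule that[of "max A (Y powr (p + 1))"])
    fix x :: real assume x: "x \<ge> 0"
    have le: "x powr (p + 1) / (p + 1) \<le> x powr (p + 1)"
      using p by (simp add: divide_le_eq mult_le_cancel_left1)
    show "x powr (p + 1) / (p + 1) \<le> x\<^sup>2 / 4 + max A (Y powr (p + 1))"
    proof (cases "x \<le> Y")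
      case True
      have "x powr (p + 1) \<le> Y powr (p + 1)" using True x p by (intro powr_mono2) auto
      moreover have "0 \<le> x\<^sup>2 / 4" by simp
      ultimately show ?thesis using le by linarith
    next
      case False
      then have x0: "x > 0" using Y_def by (smt (verit) powr_ge_zero)
      have "4 = Y powr (1 - p)" using p by (simp add: Y_def powr_powr)
      also have "\<dots> \<le> x powr (1 - p)" using False p by (intro powr_mono2) (auto simp: Y_def)
      finally have "4 * x powr (p + 1) \<le> x powr (1 - p) * x powr (p + 1)" by (intro mult_right_mono) auto
      also have "\<dots> = x\<^sup>2" using x0 by (simp flip: powr_add)
      finally have "x powr (p + 1) \<le> x\<^sup>2 / 4" by simp
      moreover have "0 \<le> Y powr (p + 1)" by simp
      ultimately show ?thesis using le by linarith
    qed
  qed simp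
qed

section \<open>The energy along an orbit\<close>

lemma deriv_half_square:
  fixes v :: "real \<Rightarrow> real"
  assumes "(v has_real_derivative X) (at t within S)"
  shows "((\<lambda>t. (v t)\<^sup>2 / 2) has_real_derivative v t * X) (at t within S)"
  by (rule derivative_eq_intros assms refl | simp)+

text \<open>The weight \<open>V\<close> of the equation is kept apart from the weight
  \<open>W\<close> of the energy. For \<open>W = V\<close> only the term with the sign of
  \<open>D\<close> remains; for \<open>W = 1\<close> only the perturbation by 1 -
  \<open>V\<close>.\<close>

lemma deriv_energy:
  fixes h v W :: "real \<Rightarrow> real"
  assumes p: "0 < p" and "h t > 0"
    and dh: "(h has_real_derivative \<eta> * v t) (at t)"
    and dv: "(v has_real_derivative \<eta> * (h t powr p - V * h t)) (at t)"
    and dW: "(W has_real_derivative D) (at t)"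
  shows "((\<lambda>t. energy p (W t) (h t) (v t)) has_real_derivative
    \<eta> * v t * h t * (W t - V) + D * (h t)\<^sup>2 / 2) (at t)"
proof -
  have d1: "((\<lambda>t. h t powr (p + 1) / (p + 1)) has_real_derivative h t powr p * (\<eta> * v t)) (at t)"
    using DERIV_cdivide[OF DERIV_chain2[OF has_real_derivative_powr[OF \<open>h t > 0\<close>, of "p + 1"] dh], of "p + 1"] p
    by simp
  have d2: "((\<lambda>t. (v t)\<^sup>2 / 2) has_real_derivative v t * (\<eta> * (h t powr p - V * h t))) (at t)"
    by (rule deriv_half_square[OF dv])
  have d3: "((\<lambda>t. W t * (h t)\<^sup>2 / 2) has_real_derivative D * (h t)\<^sup>2 / 2 + W t * (h t * (\<eta> * v t))) (at t)"
    using DERIV_mult[OF dW deriv_half_square[OF dh]] by (simp add: mult.commute)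
  show ?thesis
    unfolding energy_def by (rule derivative_eq_intros d1 d2 d3 refl)+ (simp add: algebra_simps)
qed

text \<open>Time 1 is \<xi> = 0, where the power need not be differentiable, hence t < 1. The
  degenerate \<eta> = 0 is included because the continuity argument in \<eta> starts there.\<close>

lemma deriv_weight:
  fixes \<eta> \<sigma> t :: real
  assumes "0 \<le> \<eta>" "t < 1" "0 < \<sigma>"
  obtains D where "D \<le> 0" "((\<lambda>t. (\<eta> * (1 - t)) powr \<sigma>) has_real_derivative D) (at t)"
proof (cases "\<eta> = 0")
  case True
  then show ?thesis using that[of 0] by simp
next
  case False
  then have "0 < \<eta> * (1 - t)" using assms by simp
  then have "((\<lambda>t. (\<eta> * (1 - t)) powr \<sigma>) has_real_derivative
     - (\<eta> * \<sigma> * (\<eta> * (1 - t)) powr (\<sigma> - 1))) (at t)"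
    by (auto intro!: derivative_eq_intros)
  then show ?thesis using that assms by (metis mult_nonneg_nonneg neg_le_0_iff_le order_less_imp_le powr_ge_zero)
qed

lemma continuous_on_weight:
  fixes \<eta> \<sigma> :: real
  assumes "0 < \<sigma>" "0 \<le> \<eta>" "S \<subseteq> {0..1}"
  shows "continuous_on S (\<lambda>t. (\<eta> * (1 - t)) powr \<sigma>)"
  using assms by (intro continuous_on_powr' continuous_intros) (auto simp: subset_iff)

lemma continuous_on_energy:
  assumes "continuous_on S W" "continuous_on S h" "continuous_on S v" "0 < p" "\<forall>t\<in>S. h t \<ge> 0"
  shows "continuous_on S (\<lambda>t. energy p (W t) (h t) (v t))"
  unfolding energy_def
  using assms by (intro continuous_intros continuous_on_powr') auto

text \<open>Backwards the weight decreases, and its derivative is all that remains in the derivative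
  of the energy. The equation is asked for on (0, t) only, so that the lemma also applies up to a
  first exit time, before positivity on [0, 1] is known.\<close>

lemma energy_antitone:
  fixes h v :: "real \<Rightarrow> real"
  assumes p: "0 < p" and \<sigma>: "0 < \<sigma>" and \<eta>: "0 \<le> \<eta>" and t: "0 \<le> t" "t \<le> 1"
    and dh: "\<And>s. 0 < s \<Longrightarrow> s < t \<Longrightarrow> (h has_real_derivative \<eta> * v s) (at s)"
    and dv: "\<And>s. 0 < s \<Longrightarrow> s < t \<Longrightarrow> (v has_real_derivative \<eta> * (h s powr p - (\<eta> * (1 - s)) powr \<sigma> * h s)) (at s)"
    and ch: "continuous_on {0..t} h" and cv: "continuous_on {0..t} v"
    and pos: "\<And>s. 0 \<le> s \<Longrightarrow> s \<le> t \<Longrightarrow> h s > 0"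
  shows "energy p ((\<eta> * (1 - t)) powr \<sigma>) (h t) (v t) \<le> energy p (\<eta> powr \<sigma>) (h 0) (v 0)"
proof -
  have "energy p ((\<eta> * (1 - t)) powr \<sigma>) (h t) (v t) \<le> energy p ((\<eta> * (1 - 0)) powr \<sigma>) (h 0) (v 0)"
  proof (rule DERIV_nonpos_imp_decreasing_open[OF t(1), of "\<lambda>s. energy p ((\<eta> * (1 - s)) powr \<sigma>) (h s) (v s)"])
    show "continuous_on {0..t} (\<lambda>s. energy p ((\<eta> * (1 - s)) powr \<sigma>) (h s) (v s))"
      using t pos p by (intro continuous_on_energy continuous_on_weight \<sigma> \<eta> ch cv) (auto simp: less_imp_le)
    fix s assume s: "0 < s" "s < t"
    obtain D where D: "D \<le> 0" "((\<lambda>t. (\<eta> * (1 - t)) powr \<sigma>) has_real_derivative D) (at s)"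
      using deriv_weight[of \<eta> s \<sigma>] \<eta> \<sigma> s t by auto
    have "((\<lambda>s. energy p ((\<eta> * (1 - s)) powr \<sigma>) (h s) (v s)) has_real_derivative D * (h s)\<^sup>2 / 2) (at s)"
      using deriv_energy[OF p pos[of s] dh[OF s] dv[OF s] D(2)] s by simp
    then show "\<exists>y. ((\<lambda>s. energy p ((\<eta> * (1 - s)) powr \<sigma>) (h s) (v s)) has_real_derivative y) (at s) \<and> y \<le> 0"
      using D(1) by (intro exI[of _ "D * (h s)\<^sup>2 / 2"]) (auto simp: mult_nonpos_nonneg)
  qed
  then show ?thesis by simp
qed

text \<open>A majorant of \<open>\<bar>1 - \<xi> powr \<sigma>\<bar>\<close> on \<open>[0, R]\<close> without a case distinction at \<open>\<xi> = 1\<close>; its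
  primitive \<open>drift\<close> is explicit and tends to \<open>0\<close> with \<open>\<sigma>\<close>.\<close>

definition drift_rate :: "real \<Rightarrow> real \<Rightarrow> real \<Rightarrow> real" where
  "drift_rate R \<sigma> \<xi> = 1 - \<xi> powr \<sigma> + 2 * (R powr \<sigma> - 1)"

definition drift :: "real \<Rightarrow> real \<Rightarrow> real \<Rightarrow> real" where
  "drift R \<sigma> \<xi> = \<xi> - \<xi> powr (\<sigma> + 1) / (\<sigma> + 1) + 2 * (R powr \<sigma> - 1) * \<xi>"

lemma abs_le_drift_rate:
  assumes "1 \<le> R" "0 < \<sigma>" "0 \<le> \<xi>" "\<xi> \<le> R"
  shows "\<bar>1 - \<xi> powr \<sigma>\<bar> \<le> drift_rate R \<sigma> \<xi>"
proof -
  have "\<xi> powr \<sigma> \<le> R powr \<sigma>" using assms by (intro powr_mono2) auto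
  moreover have "1 powr \<sigma> \<le> R powr \<sigma>" using assms by (intro powr_mono2) auto
  ultimately show ?thesis by (auto simp: drift_rate_def)
qed

lemma drift_0 [simp]: "drift R \<sigma> 0 = 0" by (simp add: drift_def)

lemma continuous_on_drift: "0 < \<sigma> \<Longrightarrow> S \<subseteq> {0..} \<Longrightarrow> continuous_on S (drift R \<sigma>)"
  unfolding drift_def by (intro continuous_intros continuous_on_powr') auto

lemma deriv_drift: "0 < \<sigma> \<Longrightarrow> 0 < \<xi> \<Longrightarrow> (drift R \<sigma> has_real_derivative drift_rate R \<sigma> \<xi>) (at \<xi>)"
  unfolding drift_def drift_rate_def by (rule derivative_eq_intros refl | simp)+

lemma drift_mono:
  assumes "1 \<le> R" "0 < \<sigma>" "0 \<le> x" "x \<le> y" "y \<le> R"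
  shows "drift R \<sigma> x \<le> drift R \<sigma> y"
proof (rule DERIV_nonneg_imp_increasing_open[OF assms(4)])
  show "continuous_on {x..y} (drift R \<sigma>)" using assms by (intro continuous_on_drift) auto
  fix z assume "x < z" "z < y"
  then show "\<exists>d. (drift R \<sigma> has_real_derivative d) (at z) \<and> 0 \<le> d"
    using deriv_drift[of \<sigma> z R] abs_le_drift_rate[of R \<sigma> z] assms
    by (intro exI[of _ "drift_rate R \<sigma> z"]) auto
qed

lemma drift_nonneg: "1 \<le> R \<Longrightarrow> 0 < \<sigma> \<Longrightarrow> 0 \<le> y \<Longrightarrow> y \<le> R \<Longrightarrow> 0 \<le> drift R \<sigma> y"
  using drift_mono[of R \<sigma> 0 y] by simp

lemma deriv_drift_comp:
  assumes "0 < \<sigma>" "0 \<le> \<eta>" "t < 1"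
  shows "((\<lambda>t. drift R \<sigma> (\<eta> * (1 - t))) has_real_derivative - \<eta> * drift_rate R \<sigma> (\<eta> * (1 - t))) (at t)"
proof (cases "\<eta> = 0")
  case False
  then have "0 < \<eta> * (1 - t)" using assms by simp
  moreover have "((\<lambda>t. \<eta> * (1 - t)) has_real_derivative - \<eta>) (at t)"
    by (auto intro!: derivative_eq_intros)
  ultimately show ?thesis using DERIV_chain2[OF deriv_drift[OF assms(1)], of "\<lambda>t. \<eta> * (1 - t)" t "-\<eta>"]
    by (simp add: mult.commute)
qed simp

lemma continuous_on_drift_comp:
  assumes "0 < \<sigma>" "0 \<le> \<eta>" "S \<subseteq> {0..1}"
  shows "continuous_on S (\<lambda>t. drift R \<sigma> (\<eta> * (1 - t)))"
proof (rule continuous_on_compose2[OF continuous_on_drift[OF assms(1) order_refl]])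
  show "continuous_on S (\<lambda>t. \<eta> * (1 - t))" by (intro continuous_intros)
qed (use assms in \<open>auto simp: subset_iff\<close>)

lemma tendsto_drift_0:
  assumes "1 \<le> R"
  shows "((\<lambda>\<sigma>. drift R \<sigma> R) \<longlongrightarrow> 0) (at_right 0)"
proof -
  have "((\<lambda>\<sigma>. drift R \<sigma> R) \<longlongrightarrow> R - R powr (0 + 1) / (0 + 1) + 2 * (R powr 0 - 1) * R) (at_right 0)"
    unfolding drift_def by (intro tendsto_intros) (use assms in auto)
  then show ?thesis using assms by simp
qed

section \<open>Orbits started near the interface\<close>

text \<open>\<open>R powr \<sigma> \<le> 2\<close> and the first part of \<open>h0\<close> make the
  monotone energy nonpositive at the start; the second part keeps the autonomous energy above
  \<open>- energy_gap p / 4\<close> there. The \<open>drift\<close> conditions keep the latter above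
  \<open>- energy_gap p / 2\<close> at all times and let it, increased by \<open>C\<close>, grow at
  most by the factor 2. The constants involve neither \<eta> nor the initial height, which later
  gives compactness.\<close>

locale backward_orbit =
  fixes p \<sigma> R C \<eta> :: real and h v :: "real \<Rightarrow> real"
  assumes p: "0 < p" "p < 1" and \<sigma>: "0 < \<sigma>"
    and R: "1 \<le> R" "R powr \<sigma> \<le> 2"
    and C: "energy_gap p \<le> C" "\<And>x. 0 \<le> x \<Longrightarrow> x powr (p + 1) / (p + 1) \<le> x\<^sup>2 / 4 + C"
    and drift: "8 * C * drift R \<sigma> R \<le> energy_gap p" "2 * drift R \<sigma> R \<le> ln 2"
    and \<eta>: "0 \<le> \<eta>" "\<eta> \<le> R"
    and dh: "\<And>t. t \<in> {0..1} \<Longrightarrow> (h has_real_derivative \<eta> * v t) (at t within {0..1})"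
    and dv: "\<And>t. t \<in> {0..1} \<Longrightarrow>
      (v has_real_derivative \<eta> * (h t powr p - (\<eta> * (1 - t)) powr \<sigma> * h t)) (at t within {0..1})"
    and pos: "\<And>t. t \<in> {0..1} \<Longrightarrow> 0 < h t"
    and v0: "v 0 = 0"
    and h0: "2 * (h 0)\<^sup>2 \<le> h 0 powr (p + 1) / (p + 1)" "h 0 powr (p + 1) / (p + 1) \<le> energy_gap p / 4"
begin

definition weight where "weight t = (\<eta> * (1 - t)) powr \<sigma>"

lemma gap_pos: "0 < energy_gap p" using p by (simp add: energy_gap_def)

lemma C_pos: "0 < C" using C(1) gap_pos by linarith

lemma dh': "0 < t \<Longrightarrow> t < 1 \<Longrightarrow> (h has_real_derivative \<eta> * v t) (at t)"
  using dh[of t] by (simp add: at_within_Icc_at)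

lemma dv': "0 < t \<Longrightarrow> t < 1 \<Longrightarrow> (v has_real_derivative \<eta> * (h t powr p - weight t * h t)) (at t)"
  using dv[of t] by (simp add: at_within_Icc_at weight_def)

lemma cont_h: "continuous_on {0..1} h"
  using dh DERIV_continuous continuous_on_eq_continuous_within by blast

lemma cont_v: "continuous_on {0..1} v"
  using dv DERIV_continuous continuous_on_eq_continuous_within by blast

lemma cont_weight: "continuous_on {0..1} weight"
  unfolding weight_def using \<sigma> \<eta> by (intro continuous_on_weight) auto

lemma base_range: "t \<in> {0..1} \<Longrightarrow> 0 \<le> \<eta> * (1 - t) \<and> \<eta> * (1 - t) \<le> R"
  using \<eta> by (auto intro: order_trans[OF mult_left_le])

lemma weight_range: "t \<in> {0..1} \<Longrightarrow> 0 \<le> weight t \<and> weight t \<le> 2"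
  using base_range[of t] powr_mono2[of \<sigma> "\<eta> * (1 - t)" R] \<sigma> R by (auto simp: weight_def)

text \<open>The weight is at most 2, so the initial energy is nonpositive, and it decreases in t.
  Dropping the weighted square leaves a bound of the speed by the height, on which the estimates
  near 0 rest.\<close>

lemma energy_nonpos:
  assumes t: "t \<in> {0..1}"
  shows "(v t)\<^sup>2 \<le> 2 * (h t powr (p + 1) / (p + 1))"
proof -
  have "energy p ((\<eta> * (1 - t)) powr \<sigma>) (h t) (v t) \<le> energy p (\<eta> powr \<sigma>) (h 0) (v 0)"
  proof (rule energy_antitone)
    show "continuous_on {0..t} h" "continuous_on {0..t} v"
      using t by (auto intro: continuous_on_subset[OF cont_h] continuous_on_subset[OF cont_v])
    fix s assume "0 < s" "s < t"
    then show "(h has_real_derivative \<eta> * v s) (at s)"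
      "(v has_real_derivative \<eta> * (h s powr p - (\<eta> * (1 - s)) powr \<sigma> * h s)) (at s)"
      using dh'[of s] dv'[of s] t by (auto simp: weight_def)
  qed (use p \<sigma> \<eta> t pos in auto)
  also have "\<dots> \<le> 0"
  proof -
    have "\<eta> powr \<sigma> * (h 0)\<^sup>2 \<le> 2 * (h 0)\<^sup>2"
      using weight_range[of 0] by (intro mult_right_mono) (auto simp: weight_def)
    moreover have "energy p (\<eta> powr \<sigma>) (h 0) (v 0) = \<eta> powr \<sigma> * (h 0)\<^sup>2 / 2 - h 0 powr (p + 1) / (p + 1)"
      by (simp add: energy_def v0)
    moreover have "0 \<le> (h 0)\<^sup>2" by simp
    ultimately show ?thesis using h0(1) by linarith
  qed
  finally have "(v t)\<^sup>2 / 2 - h t powr (p + 1) / (p + 1) + weight t * (h t)\<^sup>2 / 2 \<le> 0"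
    by (simp add: energy_def weight_def)
  moreover have "0 \<le> weight t * (h t)\<^sup>2 / 2" using weight_range[OF t] by simp
  ultimately show ?thesis by linarith
qed

lemma coercive:
  assumes "0 \<le> x" shows "y\<^sup>2 / 2 + x\<^sup>2 / 4 \<le> energy p 1 x y + C"
  using C(2)[OF assms] by (simp add: energy_def)

text \<open>Gronwall's argument with an explicit integrating factor. Adding \<open>C\<close> makes
  the energy coercive, so its derivative is at most \<open>2 * \<eta> * r * e\<close> in absolute
  value, and \<open>2 * \<eta> * r\<close> is the derivative of \<open>- 2 * b\<close>. Thus
  \<open>e * exp (2 * b)\<close> decreases and \<open>e * exp (- 2 * b)\<close> increases.\<close>

lemma energy_drift:
  assumes t: "t \<in> {0..1}"
  shows "energy p 1 (h t) (v t) + C \<le> (energy p 1 (h 0) 0 + C) * exp (2 * drift R \<sigma> R)" (is ?A)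
    and "energy p 1 (h t) (v t) + C \<ge> (energy p 1 (h 0) 0 + C) * exp (- 2 * drift R \<sigma> R)" (is ?B)
proof -
  define e where "e s = energy p 1 (h s) (v s) + C" for s
  define b where "b s = drift R \<sigma> (\<eta> * (1 - s))" for s
  define r where "r s = drift_rate R \<sigma> (\<eta> * (1 - s))" for s
  have e0: "0 \<le> e s" if "s \<in> {0..1}" for s
    using coercive[of "h s" "v s"] pos[OF that] by (auto simp: e_def intro: order_trans[rotated])
  have b_range: "0 \<le> b s" "b s \<le> drift R \<sigma> R" if "s \<in> {0..1}" for s
    using base_range[OF that] R \<sigma> by (auto simp: b_def intro: drift_nonneg drift_mono)
  have ce: "continuous_on {0..t} e"
    unfolding e_def using p t
    by (intro continuous_intros continuous_on_energy continuous_on_subset[OF cont_h] continuous_on_subset[OF cont_v])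
       (auto simp: pos less_imp_le)
  have cb: "continuous_on {0..t} b" unfolding b_def
    using \<sigma> \<eta> t by (intro continuous_on_drift_comp) auto
  have de: "(e has_real_derivative \<eta> * v s * h s * (1 - weight s)) (at s)" if "0 < s" "s < 1" for s
    unfolding e_def using deriv_energy[where h=h and v=v and t=s and W="\<lambda>_. 1" and D=0, OF p(1) pos dh' dv' DERIV_const] that
    by (auto intro!: derivative_eq_intros)
  have db: "(b has_real_derivative - \<eta> * r s) (at s)" if "0 < s" "s < 1" for s
    unfolding b_def r_def using that \<sigma> \<eta> by (intro deriv_drift_comp) auto
  have abs_de: "\<bar>\<eta> * v s * h s * (1 - weight s)\<bar> \<le> 2 * \<eta> * r s * e s" if s: "0 < s" "s < 1" for s
  proof -
    have "2 * \<bar>v s * h s\<bar> \<le> (v s)\<^sup>2 + (h s)\<^sup>2"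
      using sum_squares_bound[of "\<bar>v s\<bar>" "\<bar>h s\<bar>"] by (simp add: abs_mult)
    also have "\<dots> \<le> 4 * e s"
    proof -
      have "(v s)\<^sup>2 / 2 + (h s)\<^sup>2 / 4 \<le> e s" using coercive[of "h s" "v s"] pos[of s] s by (simp add: e_def)
      moreover have "0 \<le> (v s)\<^sup>2" "0 \<le> (h s)\<^sup>2" by auto
      ultimately show ?thesis by linarith
    qed
    finally have 1: "\<bar>v s * h s\<bar> \<le> 2 * e s" by simp
    have 2: "\<bar>1 - weight s\<bar> \<le> r s"
      unfolding weight_def r_def using R \<sigma> base_range[of s] s by (intro abs_le_drift_rate) auto
    have "\<bar>\<eta> * v s * h s * (1 - weight s)\<bar> = \<eta> * (\<bar>v s * h s\<bar> * \<bar>1 - weight s\<bar>)"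
      using \<eta> by (simp add: abs_mult)
    also have "\<dots> \<le> \<eta> * ((2 * e s) * r s)"
      using 1 2 \<eta> e0[of s] s by (intro mult_left_mono mult_mono) auto
    finally show ?thesis by (simp add: mult_ac)
  qed
  have "e t * exp (2 * b t) \<le> e 0 * exp (2 * b 0)"
  proof (rule DERIV_nonpos_imp_decreasing_open[of 0 t "\<lambda>s. e s * exp (2 * b s)"])
    fix s assume s: "0 < s" "s < t"
    then have s1: "s < 1" using t by simp
    have "((\<lambda>s. e s * exp (2 * b s)) has_real_derivative
       exp (2 * b s) * (\<eta> * v s * h s * (1 - weight s) - 2 * \<eta> * r s * e s)) (at s)"
      by (rule derivative_eq_intros de[OF s(1) s1] db[OF s(1) s1] refl)+ (simp add: algebra_simps)
    moreover have "exp (2 * b s) * (\<eta> * v s * h s * (1 - weight s) - 2 * \<eta> * r s * e s) \<le> 0"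
      using abs_de[OF s(1) s1] by (intro mult_nonneg_nonpos) auto
    ultimately show "\<exists>y. ((\<lambda>s. e s * exp (2 * b s)) has_real_derivative y) (at s) \<and> y \<le> 0" by blast
  qed (use t in \<open>auto intro!: continuous_intros ce cb\<close>)
  also have "\<dots> \<le> e 0 * exp (2 * drift R \<sigma> R)"
    using b_range[of 0] e0[of 0] by (intro mult_left_mono) auto
  finally have "e t * exp (2 * b t) \<le> e 0 * exp (2 * drift R \<sigma> R)" .
  moreover have "e t * 1 \<le> e t * exp (2 * b t)" using b_range[OF t] e0[OF t] by (intro mult_left_mono) auto
  ultimately show ?A by (simp add: e_def v0)
  have "e 0 * exp (- 2 * drift R \<sigma> R) \<le> e 0 * exp (- 2 * b 0)"
    using b_range[of 0] e0[of 0] by (intro mult_left_mono) auto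
  also have "\<dots> \<le> e t * exp (- 2 * b t)"
  proof (rule DERIV_nonneg_imp_increasing_open[of 0 t "\<lambda>s. e s * exp (- 2 * b s)"])
    fix s assume s: "0 < s" "s < t"
    then have s1: "s < 1" using t by simp
    have "((\<lambda>s. e s * exp (- 2 * b s)) has_real_derivative
       exp (- 2 * b s) * (\<eta> * v s * h s * (1 - weight s) + 2 * \<eta> * r s * e s)) (at s)"
      by (rule derivative_eq_intros de[OF s(1) s1] db[OF s(1) s1] refl)+ (simp add: algebra_simps)
    moreover have "exp (- 2 * b s) * (\<eta> * v s * h s * (1 - weight s) + 2 * \<eta> * r s * e s) \<ge> 0"
      using abs_de[OF s(1) s1] by (intro mult_nonneg_nonneg) auto
    ultimately show "\<exists>y. ((\<lambda>s. e s * exp (- 2 * b s)) has_real_derivative y) (at s) \<and> 0 \<le> y" by blast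
  qed (use t in \<open>auto intro!: continuous_intros ce cb\<close>)
  also have "\<dots> \<le> e t * 1" using b_range[OF t] e0[OF t] by (intro mult_left_mono) auto
  finally show ?B by (simp add: e_def v0)
qed

lemma energy_0_range: "- energy_gap p / 4 \<le> energy p 1 (h 0) 0" "energy p 1 (h 0) 0 \<le> 0"
proof -
  have "0 \<le> (h 0)\<^sup>2" by simp
  moreover have "energy p 1 (h 0) 0 = (h 0)\<^sup>2 / 2 - h 0 powr (p + 1) / (p + 1)" by (simp add: energy_def)
  ultimately show "- energy_gap p / 4 \<le> energy p 1 (h 0) 0" "energy p 1 (h 0) 0 \<le> 0"
    using h0 by linarith+
qed

lemma bounds:
  assumes t: "t \<in> {0..1}"
  shows "(h t)\<^sup>2 \<le> 8 * C" and "(v t)\<^sup>2 \<le> 8 * C"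
proof -
  have "exp (2 * drift R \<sigma> R) \<le> 2"
    using drift(2) by (metis exp_le_cancel_iff exp_ln zero_less_numeral)
  then have "(energy p 1 (h 0) 0 + C) * exp (2 * drift R \<sigma> R) \<le> C * 2"
    using energy_0_range(2) C_pos by (intro mult_mono) auto
  then have "(v t)\<^sup>2 / 2 + (h t)\<^sup>2 / 4 \<le> 2 * C"
    using energy_drift(1)[OF t] coercive[of "h t" "v t"] pos[OF t] by linarith
  moreover have "0 \<le> (v t)\<^sup>2" "0 \<le> (h t)\<^sup>2" by auto
  ultimately show "(h t)\<^sup>2 \<le> 8 * C" and "(v t)\<^sup>2 \<le> 8 * C" by linarith+
qed

text \<open>At most a quarter of the gap is lost at the start and, by the first \<open>drift\<close>
  condition, at most another quarter on the way. The half that remains bounds the distance from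
  below.\<close>

lemma away_from_equilibrium:
  assumes t: "t \<in> {0..1}"
  shows "energy_gap p \<le> (h t - 1)\<^sup>2 + (v t)\<^sup>2"
proof -
  have d0: "0 \<le> drift R \<sigma> R" using R \<sigma> by (intro drift_nonneg) auto
  have "C - energy_gap p / 2 \<le> (C - energy_gap p / 4) * (1 - 2 * drift R \<sigma> R)"
  proof -
    have "0 \<le> energy_gap p * drift R \<sigma> R" using gap_pos d0 by simp
    moreover have "(C - energy_gap p / 4) * (1 - 2 * drift R \<sigma> R) =
       C - energy_gap p / 4 - 2 * (C * drift R \<sigma> R) + energy_gap p * drift R \<sigma> R / 2"
      by (simp add: algebra_simps)
    ultimately show ?thesis using drift(1) by linarith
  qed
  also have "\<dots> \<le> (C - energy_gap p / 4) * exp (- 2 * drift R \<sigma> R)"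
    using exp_ge_add_one_self[of "- 2 * drift R \<sigma> R"] C gap_pos by (intro mult_left_mono) auto
  also have "\<dots> \<le> (energy p 1 (h 0) 0 + C) * exp (- 2 * drift R \<sigma> R)"
    using energy_0_range(1) by (intro mult_right_mono) auto
  also have "\<dots> \<le> energy p 1 (h t) (v t) + C" by (rule energy_drift(2)[OF t])
  finally have "energy_gap p \<le> 2 * (energy p 1 (h t) (v t) + energy_gap p)" by simp
  also have "\<dots> \<le> (h t - 1)\<^sup>2 + (v t)\<^sup>2"
    using pos[OF t] p by (intro dist_equilibrium_ge_energy) auto
  finally show ?thesis .
qed

end

section \<open>Rotation about the equilibrium\<close>

text \<open>The polar angle of \<open>(u, y)\<close> with \<open>u = x - 1\<close> has derivative
  \<open>(u * y' - y * u') / (u\<^sup>2 + y\<^sup>2)\<close>; here the equation is inserted for the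
  derivatives.\<close>

definition angular_rate :: "real \<Rightarrow> real \<Rightarrow> real \<Rightarrow> real \<Rightarrow> real \<Rightarrow> real \<Rightarrow> real" where
  "angular_rate p \<sigma> \<eta> t x y =
     \<eta> * ((x - 1) * (x powr p - (\<eta> * (1 - t)) powr \<sigma> * x) - y\<^sup>2) / ((x - 1)\<^sup>2 + y\<^sup>2)"

text \<open>Equals \<open>1 - 2 * p / (p + 1)\<close>: what remains, near height 0, of the growth of
  \<open>v / h powr p\<close> per unit of \<xi> after the quadratic term in v is bounded through the
  nonpositive energy.\<close>

definition escape_rate :: "real \<Rightarrow> real" where
  "escape_rate p = (1 - p) / (1 + p)"

text \<open>Below this height a weight of at most 2 times \<open>h powr (1 - p)\<close> consumes at
  most half of the escape rate, hence the quarter.\<close>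

definition low_height :: "real \<Rightarrow> real" where
  "low_height p = (escape_rate p / 4) powr (1 / (1 - p))"

text \<open>An upper bound for the weighted \<open>h powr (1 - p)\<close>, divided by a lower bound
  for the autonomous angular speed above \<open>low_height p\<close>: the exchange rate between
  slope and angle.\<close>

definition rotation_deficit :: "real \<Rightarrow> real \<Rightarrow> real" where
  "rotation_deficit p C = 2 * sqrt (8 * C) powr (1 - p) / ((1 - p) * low_height p powr p)"

text \<open>Bound for the coefficient of 1 - \<open>weight\<close> in the angular rate:
  \<open>\<bar>(h - 1) * h\<bar>\<close> over the squared distance to the equilibrium.\<close>

definition drift_effect :: "real \<Rightarrow> real \<Rightarrow> real" where
  "drift_effect p C = (sqrt (8 * C) + 1) * sqrt (8 * C) / energy_gap p"

lemma escape_rate_range: "0 < p \<Longrightarrow> p < 1 \<Longrightarrow> 0 < escape_rate p \<and> escape_rate p < 1"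
  by (simp add: escape_rate_def)

lemma low_height_range:
  assumes "0 < p" "p < 1"
  shows "0 < low_height p" "low_height p \<le> 1"
proof -
  have "(escape_rate p / 4) powr (1 / (1 - p)) \<le> 1 powr (1 / (1 - p))"
    using escape_rate_range[OF assms] assms by (intro powr_mono2) auto
  then show "0 < low_height p" "low_height p \<le> 1"
    using escape_rate_range[OF assms] by (auto simp: low_height_def)
qed

lemma low_height_powr:
  assumes "0 < p" "p < 1"
  shows "low_height p powr (1 - p) = escape_rate p / 4"
  using escape_rate_range[OF assms] assms by (simp add: low_height_def powr_powr)

text \<open>If \<open>T\<close> is the angle swept by \<open>(y, v)\<close>, then \<open>y * sin T - v * cos T\<close> divided by the radius is the sine
  of \<open>T\<close> minus the polar angle of \<open>(y, v)\<close>, hence constant.\<close>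

lemma angle_defect_conserved:
  fixes y v T :: "real \<Rightarrow> real" and F :: real
  assumes dy: "(y has_real_derivative \<eta> * v t) (at t)"
    and dv: "(v has_real_derivative \<eta> * F) (at t)"
    and dT: "(T has_real_derivative \<eta> * (y t * F - (v t)\<^sup>2) / ((y t)\<^sup>2 + (v t)\<^sup>2)) (at t)"
    and r: "(y t)\<^sup>2 + (v t)\<^sup>2 > 0"
  shows "((\<lambda>t. (y t * sin (T t) - v t * cos (T t))\<^sup>2 / ((y t)\<^sup>2 + (v t)\<^sup>2)) has_real_derivative 0) (at t)"
proof -
  define T' where "T' = \<eta> * (y t * F - (v t)\<^sup>2) / ((y t)\<^sup>2 + (v t)\<^sup>2)"
  define A where "A t = y t * sin (T t) - v t * cos (T t)" for t
  define A' where "A' = \<eta> * v t * sin (T t) + y t * (cos (T t) * T') - (\<eta> * F * cos (T t) - v t * (sin (T t) * T'))"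
  have T'r: "T' * ((y t)\<^sup>2 + (v t)\<^sup>2) = \<eta> * (y t * F - (v t)\<^sup>2)"
    using r by (simp add: T'_def)
  have dA: "(A has_real_derivative A') (at t)"
    unfolding A_def A'_def
    by (rule derivative_eq_intros dy dv dT[folded T'_def] refl)+ (simp add: algebra_simps)
  have dr: "((\<lambda>t. (y t)\<^sup>2 + (v t)\<^sup>2) has_real_derivative 2 * (y t * (\<eta> * v t) + v t * (\<eta> * F))) (at t)"
    using DERIV_cmult[OF DERIV_add[OF deriv_half_square[OF dy] deriv_half_square[OF dv]], of 2]
    by simp
  have dA2: "((\<lambda>t. (A t)\<^sup>2) has_real_derivative 2 * (A t * A')) (at t)"
    using DERIV_cmult[OF deriv_half_square[OF dA], of 2] by simp
  have "A' * ((y t)\<^sup>2 + (v t)\<^sup>2) = \<eta> * v t * sin (T t) * ((y t)\<^sup>2 + (v t)\<^sup>2) - \<eta> * F * cos (T t) * ((y t)\<^sup>2 + (v t)\<^sup>2)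
     + (y t * cos (T t) + v t * sin (T t)) * (T' * ((y t)\<^sup>2 + (v t)\<^sup>2))"
    unfolding A'_def by (simp add: algebra_simps)
  also have "\<dots> = (y t * (\<eta> * v t) + v t * (\<eta> * F)) * A t"
    unfolding T'r A_def by (simp add: algebra_simps power2_eq_square)
  finally have eq: "A' * ((y t)\<^sup>2 + (v t)\<^sup>2) = (y t * (\<eta> * v t) + v t * (\<eta> * F)) * A t" .
  have "2 * (A t * A') * ((y t)\<^sup>2 + (v t)\<^sup>2) = 2 * A t * (A' * ((y t)\<^sup>2 + (v t)\<^sup>2))"
    by (simp only: mult_ac)
  also have "\<dots> = (A t)\<^sup>2 * (2 * (y t * (\<eta> * v t) + v t * (\<eta> * F)))"
    unfolding eq by (simp only: power2_eq_square mult_ac)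
  finally have "2 * (A t * A') * ((y t)\<^sup>2 + (v t)\<^sup>2) = (A t)\<^sup>2 * (2 * (y t * (\<eta> * v t) + v t * (\<eta> * F)))" .
  then show ?thesis
    using DERIV_divide[OF dA2 dr less_imp_neq[OF r, symmetric]] by (simp add: A_def)
qed

context backward_orbit
begin

definition angle where "angle t = integral {0..t} (\<lambda>s. angular_rate p \<sigma> \<eta> s (h s) (v s))"

lemma dist_pos: "t \<in> {0..1} \<Longrightarrow> 0 < (h t - 1)\<^sup>2 + (v t)\<^sup>2"
  using away_from_equilibrium[of t] gap_pos by linarith

lemma cont_angular_rate: "continuous_on {0..1} (\<lambda>s. angular_rate p \<sigma> \<eta> s (h s) (v s))"
proof -
  have "continuous_on {0..1} (\<lambda>s. h s powr p)"
    using pos p by (intro continuous_on_powr' cont_h continuous_intros) (auto simp: less_imp_le)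
  then show ?thesis
    unfolding angular_rate_def weight_def[symmetric] using dist_pos pos
    by (intro continuous_intros cont_h cont_v cont_weight) (force simp: less_le)+
qed

lemma deriv_angle:
  assumes "0 < t" "t < 1"
  shows "(angle has_real_derivative angular_rate p \<sigma> \<eta> t (h t) (v t)) (at t)"
  using integral_has_real_derivative[OF cont_angular_rate, of t] assms
  unfolding angle_def by (simp add: at_within_Icc_at)

lemma cont_angle: "continuous_on {0..1} angle"
  unfolding angle_def
  by (rule indefinite_integral_continuous_1[OF integrable_continuous_real[OF cont_angular_rate]])

lemma angle_0 [simp]: "angle 0 = 0" by (simp add: angle_def)

text \<open>At time 0 both v and the angle vanish, so the conserved quantity is 0. At a multiple of
  pi its sine term drops out and \<open>v 1\<close> times a nonzero cosine remains.\<close>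

lemma stationary_at_half_turns:
  assumes "angle 1 = - real j * pi"
  shows "v 1 = 0"
proof -
  define f where "f t = ((h t - 1) * sin (angle t) - v t * cos (angle t))\<^sup>2 / ((h t - 1)\<^sup>2 + (v t)\<^sup>2)" for t
  have "f 1 = f 0"
  proof (rule DERIV_isconst_end[of 0 1 f])
    show "continuous_on {0..1} f" unfolding f_def using dist_pos
      by (intro continuous_intros cont_h cont_v cont_angle) (auto simp: less_le)
    fix t :: real assume t: "0 < t" "t < 1"
    have "((\<lambda>t. h t - 1) has_real_derivative \<eta> * v t) (at t)"
      using DERIV_diff[OF dh'[OF t] DERIV_const[of 1]] by simp
    from angle_defect_conserved[OF this dv'[OF t]] deriv_angle[OF t] dist_pos[of t] t
    show "(f has_real_derivative 0) (at t)"
      unfolding f_def by (simp add: angular_rate_def weight_def)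
  qed simp
  also have "f 0 = 0" by (simp add: f_def v0)
  finally have "(h 1 - 1) * sin (angle 1) - v 1 * cos (angle 1) = 0"
    using dist_pos[of 1] by (auto simp: f_def)
  moreover have "sin (angle 1) = 0" using sin_npi[of j] by (simp add: assms)
  ultimately have "v 1 * cos (angle 1) = 0" by simp
  moreover have "cos (angle 1) \<noteq> 0" using \<open>sin (angle 1) = 0\<close> by (metis cos_zero_iff sin_zero_norm_cos_one norm_zero zero_neq_one)
  ultimately show ?thesis by simp
qed

text \<open>The rotation stalls only while \<open>h\<close> is small. Since the energy is nonpositive, the derivative of
  \<open>v / h powr p\<close> is then bounded below uniformly in the initial height, whereas \<open>v / h powr p\<close> itself
  stays bounded; this limits the time spent near \<open>0\<close>.\<close>

definition slope where "slope t = v t * h t powr (- p)"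

lemma h_le: "t \<in> {0..1} \<Longrightarrow> h t \<le> sqrt (8 * C)"
  using bounds(1)[of t] by (simp add: real_le_rsqrt)

lemma abs_v_le: "t \<in> {0..1} \<Longrightarrow> \<bar>v t\<bar> \<le> sqrt (8 * C)"
  using bounds(2)[of t] by (simp add: real_le_rsqrt)

lemma slope_sq_le:
  assumes t: "t \<in> {0..1}"
  shows "(slope t)\<^sup>2 \<le> 2 / (p + 1) * h t powr (1 - p)"
proof -
  have "(slope t)\<^sup>2 = (v t)\<^sup>2 * h t powr (- 2 * p)"
    using pos[OF t] by (simp add: slope_def power_mult_distrib power2_eq_square flip: powr_add)
  also have "\<dots> \<le> 2 * (h t powr (p + 1) / (p + 1)) * h t powr (- 2 * p)"
    using energy_nonpos[OF t] by (intro mult_right_mono) auto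
  also have "\<dots> = 2 / (p + 1) * (h t powr (p + 1) * h t powr (- 2 * p))" by simp
  also have "h t powr (p + 1) * h t powr (- 2 * p) = h t powr (1 - p)"
    by (simp flip: powr_add)
  finally show ?thesis .
qed

lemma cont_slope: "continuous_on {0..1} slope"
  unfolding slope_def using pos
  by (intro continuous_intros continuous_on_powr cont_h cont_v) (force simp: less_le)

lemma slope_0 [simp]: "slope 0 = 0" by (simp add: slope_def v0)

text \<open>The product rule produces \<open>p * (v t)\<^sup>2 * h t powr (- p - 1)\<close>;
  \<open>energy_nonpos\<close> bounds it by 2 p / (p + 1), a number free of h.\<close>

lemma deriv_slope:
  assumes t: "0 < t" "t < 1"
  obtains D where "(slope has_real_derivative D) (at t)"
    "D \<ge> \<eta> * (escape_rate p - weight t * h t powr (1 - p))"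
proof -
  have ht: "h t > 0" using pos t by simp
  define D where "D = \<eta> * (h t powr p - weight t * h t) * h t powr (- p)
      + (- p * h t powr (- p - 1) * (\<eta> * v t)) * v t"
  have d: "(slope has_real_derivative D) (at t)"
    unfolding slope_def D_def
    by (rule DERIV_mult[OF dv'[OF t] DERIV_chain2[OF has_real_derivative_powr[OF ht] dh'[OF t]]])
  have 1: "h t powr p * h t powr (- p) = 1" using ht by (simp flip: powr_add)
  have 2: "h t * h t powr (- p) = h t powr (1 - p)" using ht powr_add[of "h t" 1 "-p"] by simp
  have "(v t)\<^sup>2 * h t powr (- p - 1) \<le> 2 * (h t powr (p + 1) / (p + 1)) * h t powr (- p - 1)"
    using energy_nonpos[of t] t by (intro mult_right_mono) auto
  also have "\<dots> = 2 / (p + 1) * (h t powr (p + 1) * h t powr (- p - 1))" by simp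
  also have "h t powr (p + 1) * h t powr (- p - 1) = 1" using ht by (simp flip: powr_add)
  finally have 3: "p * ((v t)\<^sup>2 * h t powr (- p - 1)) \<le> p * (2 / (p + 1) * 1)"
    using p by (intro mult_left_mono) auto
  have "D = \<eta> * ((h t powr p * h t powr (- p)) - weight t * (h t * h t powr (- p)) - p * ((v t)\<^sup>2 * h t powr (- p - 1)))"
    by (simp add: D_def algebra_simps power2_eq_square)
  also have "\<dots> \<ge> \<eta> * (1 - weight t * h t powr (1 - p) - p * (2 / (p + 1) * 1))"
    unfolding 1 2 using 3 \<eta> by (intro mult_left_mono) auto
  also have "1 - weight t * h t powr (1 - p) - p * (2 / (p + 1) * 1) = escape_rate p - weight t * h t powr (1 - p)"
    using p by (simp add: escape_rate_def field_simps)
  finally show ?thesis using that d by blast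
qed

lemma low_powr_le:
  assumes "t \<in> {0..1}" "h t \<le> low_height p"
  shows "weight t * h t powr (1 - p) \<le> escape_rate p / 2"
proof -
  have "h t powr (1 - p) \<le> low_height p powr (1 - p)"
    using assms pos p by (intro powr_mono2) (auto simp: less_imp_le)
  then have "weight t * h t powr (1 - p) \<le> 2 * (escape_rate p / 4)"
    using weight_range[OF assms(1)] low_height_powr[OF p] by (intro mult_mono) auto
  then show ?thesis by simp
qed

lemma M_pos: "0 < sqrt (8 * C)" using C_pos by simp

lemma rotation_deficit_pos: "0 < rotation_deficit p C"
  using p low_height_range[OF p] M_pos by (simp add: rotation_deficit_def)

text \<open>Either the height is low and the weighted term is at most half the escape rate, or the
  autonomous angular speed \<open>D\<close> is bounded below and \<open>rotation_deficit\<close> is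
  scaled so that it pays for the term. A single inequality spares a division of time into low and
  high phases.\<close>

lemma rotation_dominates:
  assumes t: "t \<in> {0..1}"
  defines "D \<equiv> ((h t - 1) * (h t - h t powr p) + (v t)\<^sup>2) / ((h t - 1)\<^sup>2 + (v t)\<^sup>2)"
  shows "weight t * h t powr (1 - p) \<le> escape_rate p / 2 + rotation_deficit p C * D"
proof (cases "h t \<le> low_height p")
  case True
  have "0 \<le> D" unfolding D_def using restoring_force_nonneg[OF p pos[OF t]] by simp
  then show ?thesis using low_powr_le[OF t True] rotation_deficit_pos
    by (smt (verit) mult_nonneg_nonneg)
next
  case False
  define Q where "Q = (1 - p) * low_height p powr p"
  have Q: "0 < Q" "Q \<le> 1"
  proof -
    have "low_height p powr p \<le> 1 powr p" using low_height_range[OF p] p by (intro powr_mono2) auto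
    then show "Q \<le> 1" unfolding Q_def using p by (intro mult_le_one) auto
    show "0 < Q" using p low_height_range[OF p] by (simp add: Q_def)
  qed
  have "Q * ((h t - 1)\<^sup>2 + (v t)\<^sup>2) \<le> (h t - 1) * (h t - h t powr p) + (v t)\<^sup>2"
  proof -
    have "Q * (h t - 1)\<^sup>2 \<le> (h t - 1) * (h t - h t powr p)"
      unfolding Q_def using False low_height_range[OF p] p pos[OF t]
      by (intro restoring_force_ge) auto
    moreover have "Q * (v t)\<^sup>2 \<le> 1 * (v t)\<^sup>2" using Q by (intro mult_right_mono) auto
    ultimately show ?thesis by (simp add: distrib_left)
  qed
  then have "Q \<le> D" unfolding D_def using dist_pos[OF t] by (simp add: pos_le_divide_eq)
  then have "rotation_deficit p C * Q \<le> rotation_deficit p C * D"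
    using rotation_deficit_pos by (intro mult_left_mono) auto
  moreover have "rotation_deficit p C * Q = 2 * sqrt (8 * C) powr (1 - p)"
    using Q unfolding rotation_deficit_def Q_def[symmetric] by simp
  moreover have "weight t * h t powr (1 - p) \<le> 2 * sqrt (8 * C) powr (1 - p)"
    using weight_range[OF t] h_le[OF t] pos[OF t] p by (intro mult_mono powr_mono2) auto
  ultimately show ?thesis using escape_rate_range[OF p] by linarith
qed

lemma drift_effect_nonneg: "0 \<le> drift_effect p C"
  using gap_pos C_pos by (simp add: drift_effect_def)

text \<open>Replacing the weight by 1 gives the autonomous rotation \<open>- \<eta> * D\<close>; the
  remainder is proportional to 1 - \<open>weight\<close>, which the drift rate dominates.\<close>

lemma angular_rate_le:
  assumes t: "t \<in> {0..1}"
  defines "D \<equiv> ((h t - 1) * (h t - h t powr p) + (v t)\<^sup>2) / ((h t - 1)\<^sup>2 + (v t)\<^sup>2)"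
  shows "angular_rate p \<sigma> \<eta> t (h t) (v t) \<le> - \<eta> * D + drift_effect p C * (\<eta> * drift_rate R \<sigma> (\<eta> * (1 - t)))"
proof -
  define r where "r = (h t - 1)\<^sup>2 + (v t)\<^sup>2"
  have r: "r > 0" "r \<ge> energy_gap p" using dist_pos[OF t] away_from_equilibrium[OF t] by (auto simp: r_def)
  have M0: "0 \<le> sqrt (8 * C)" using C_pos by simp
  have "\<bar>(h t - 1) * h t\<bar> \<le> (sqrt (8 * C) + 1) * sqrt (8 * C)"
    unfolding abs_mult using h_le[OF t] pos[OF t] by (intro mult_mono) auto
  then have "\<bar>(h t - 1) * h t\<bar> / r \<le> drift_effect p C"
    unfolding drift_effect_def using r gap_pos M0 by (intro frac_le) auto
  moreover have "\<bar>1 - weight t\<bar> \<le> drift_rate R \<sigma> (\<eta> * (1 - t))"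
    unfolding weight_def using R \<sigma> base_range[OF t] by (intro abs_le_drift_rate) auto
  ultimately have "\<bar>(h t - 1) * h t\<bar> / r * \<bar>1 - weight t\<bar> \<le> drift_effect p C * drift_rate R \<sigma> (\<eta> * (1 - t))"
    using drift_effect_nonneg by (intro mult_mono) auto
  then have "(h t - 1) * h t / r * (1 - weight t) \<le> drift_effect p C * drift_rate R \<sigma> (\<eta> * (1 - t))"
    using r abs_ge_self[of "(h t - 1) * h t / r * (1 - weight t)"] by (simp add: abs_mult)
  then have "\<eta> * ((h t - 1) * h t / r * (1 - weight t)) \<le> \<eta> * (drift_effect p C * drift_rate R \<sigma> (\<eta> * (1 - t)))"
    using \<eta> by (intro mult_left_mono) auto
  moreover have "angular_rate p \<sigma> \<eta> t (h t) (v t) = - \<eta> * D + \<eta> * ((h t - 1) * h t / r * (1 - weight t))"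
    unfolding angular_rate_def D_def r_def[symmetric] weight_def[symmetric]
    using r by (simp add: field_simps)
  ultimately show ?thesis by (simp add: mult_ac)
qed

text \<open>Where the angle stalls the slope grows, so the angle minus a multiple of the slope
  decreases at a guaranteed rate up to the drift, while the slope stays bounded. The bound is free
  of the initial height and falls linearly in \<eta>, so any number of half turns can be
  reached.\<close>

lemma angle_le:
  "angle 1 \<le> (1 + 2 * sqrt (8 * C) powr (1 - p) - \<eta> * escape_rate p / 2) / rotation_deficit p C
     + drift_effect p C * drift R \<sigma> R"
proof -
  define K where "K = drift_effect p C"
  define L where "L = rotation_deficit p C"
  define b where "b s = drift R \<sigma> (\<eta> * (1 - s))" for s
  define r where "r s = drift_rate R \<sigma> (\<eta> * (1 - s))" for s
  \<comment> \<open>The linear summand offsets the guaranteed rate and \<open>K * b\<close> absorbs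
    the perturbation, so that \<open>f\<close> is monotone.\<close>
  define f where "f t = angle t - slope t / L + \<eta> * escape_rate p / 2 / L * t + K * b t" for t
  have L: "L > 0" using rotation_deficit_pos by (simp add: L_def)
  have L_nz: "L \<noteq> 0" using L by simp
  have K: "K \<ge> 0" unfolding K_def by (rule drift_effect_nonneg)
  have "f 1 \<le> f 0"
  proof (rule DERIV_nonpos_imp_decreasing_open[of 0 1 f])
    show "continuous_on {0..1} f" unfolding f_def b_def using \<sigma> \<eta> L
      by (intro continuous_intros cont_angle cont_slope continuous_on_drift_comp) (auto simp: L_nz)
    fix t :: real assume t: "0 < t" "t < 1"
    then have t01: "t \<in> {0..1}" by simp
    define D where "D = ((h t - 1) * (h t - h t powr p) + (v t)\<^sup>2) / ((h t - 1)\<^sup>2 + (v t)\<^sup>2)"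
    obtain S where S: "(slope has_real_derivative S) (at t)"
      "S \<ge> \<eta> * (escape_rate p - weight t * h t powr (1 - p))" using deriv_slope[OF t] by blast
    have db: "(b has_real_derivative - \<eta> * r t) (at t)"
      unfolding b_def r_def using t \<sigma> \<eta> by (intro deriv_drift_comp) auto
    have "(f has_real_derivative angular_rate p \<sigma> \<eta> t (h t) (v t) - S / L + \<eta> * escape_rate p / 2 / L + K * (- \<eta> * r t)) (at t)"
      unfolding f_def
      by (intro DERIV_add DERIV_diff deriv_angle t DERIV_cdivide S(1) DERIV_cmult db)
        (use DERIV_cmult[OF DERIV_ident, of "\<eta> * escape_rate p / 2 / L"] in simp)
    moreover have "angular_rate p \<sigma> \<eta> t (h t) (v t) \<le> - \<eta> * D + K * (\<eta> * r t)"
      unfolding D_def K_def r_def by (rule angular_rate_le[OF t01])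
    moreover have "S / L \<ge> \<eta> * escape_rate p / 2 / L - \<eta> * D"
    proof -
      have "\<eta> * (escape_rate p - weight t * h t powr (1 - p)) \<ge> \<eta> * (escape_rate p / 2 - L * D)"
        using rotation_dominates[OF t01] \<eta> unfolding D_def L_def by (intro mult_left_mono) auto
      then have "S \<ge> \<eta> * (escape_rate p / 2 - L * D)" using S(2) by linarith
      then have "S / L \<ge> \<eta> * (escape_rate p / 2 - L * D) / L" using L by (intro divide_right_mono) auto
      then show ?thesis using L by (simp add: right_diff_distrib diff_divide_distrib)
    qed
    ultimately show "\<exists>y. (f has_real_derivative y) (at t) \<and> y \<le> 0"
      by - (rule exI, rule conjI, assumption, linarith)
  qed simp
  moreover have "f 0 = K * drift R \<sigma> \<eta>" by (simp add: f_def b_def)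
  moreover have "f 1 = angle 1 - slope 1 / L + \<eta> * escape_rate p / 2 / L" by (simp add: f_def b_def)
  moreover have "K * drift R \<sigma> \<eta> \<le> K * drift R \<sigma> R" using K R \<sigma> \<eta> by (intro mult_left_mono drift_mono) auto
  moreover have "slope 1 / L \<le> (1 + 2 * sqrt (8 * C) powr (1 - p)) / L"
  proof (intro divide_right_mono)
    have "(slope 1)\<^sup>2 \<le> 2 / (p + 1) * h 1 powr (1 - p)" by (rule slope_sq_le) simp
    also have "\<dots> \<le> 2 * sqrt (8 * C) powr (1 - p)"
      using h_le[of 1] pos[of 1] p by (intro mult_mono powr_mono2) (auto simp: field_simps)
    finally have "(slope 1)\<^sup>2 \<le> 2 * sqrt (8 * C) powr (1 - p)" .
    \<comment> \<open>Passes from the bound for the square to one for the slope without a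
      root.\<close>
    moreover have "slope 1 \<le> 1 + (slope 1)\<^sup>2"
      using sum_squares_bound[of 1 "slope 1"] zero_le_power2[of "slope 1"] by (simp, linarith)
    ultimately show "slope 1 \<le> 1 + 2 * sqrt (8 * C) powr (1 - p)" by linarith
  qed (use L in simp)
  ultimately have "angle 1 \<le> (1 + 2 * sqrt (8 * C) powr (1 - p)) / L - \<eta> * escape_rate p / 2 / L + K * drift R \<sigma> R"
    by linarith
  then show ?thesis by (simp add: K_def L_def diff_divide_distrib)
qed

text \<open>At low heights the slope is at least \<open>\<eta> * escape_rate p / 2\<close> times t,
  and \<open>h powr (1 - p)\<close> has derivative \<open>(1 - p) * \<eta> * slope\<close>;
  integration gives the quadratic bound. Being free of \<open>h 0\<close>, it prevents a collapse of
  the orbits to 0 as \<open>h 0\<close> tends to 0.\<close>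

lemma growth:
  assumes t: "t \<in> {0..1}" and low: "h 0 \<le> low_height p / 2" "\<eta> * t * sqrt (8 * C) \<le> low_height p / 2"
  shows "(1 - p) * escape_rate p * (\<eta> * t)\<^sup>2 / 4 \<le> h t powr (1 - p)"
proof -
  \<comment> \<open>The speed is at most \<open>\<eta> * M\<close>, so the second smallness
    condition keeps the orbit low up to time t.\<close>
  have h_low: "h s \<le> low_height p" if s: "0 \<le> s" "s \<le> t" for s
  proof -
    define M where "M = sqrt (8 * C)"
    have "h s - \<eta> * M * s \<le> h 0 - \<eta> * M * 0"
    proof (rule DERIV_nonpos_imp_decreasing_open[OF s(1), of "\<lambda>s. h s - \<eta> * M * s"])
      fix x assume x: "0 < x" "x < s"
      then have x1: "x < 1" using s t by simp
      have "((\<lambda>s. h s - \<eta> * M * s) has_real_derivative \<eta> * v x - \<eta> * M) (at x)"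
        by (rule derivative_eq_intros dh'[OF x(1) x1] refl | simp)+
      moreover have "\<eta> * v x \<le> \<eta> * M" using abs_v_le[of x] x x1 \<eta> by (intro mult_left_mono) (auto simp: M_def)
      ultimately show "\<exists>y. ((\<lambda>s. h s - \<eta> * M * s) has_real_derivative y) (at x) \<and> y \<le> 0"
        by - (rule exI, rule conjI, assumption, linarith)
    qed (use s t in \<open>auto intro!: continuous_intros continuous_on_subset[OF cont_h]\<close>)
    moreover have "\<eta> * M * s \<le> \<eta> * M * t" using s \<eta> M_pos by (intro mult_left_mono) (auto simp: M_def)
    ultimately show ?thesis using low by (simp add: M_def mult_ac)
  qed
  have slope_ge: "\<eta> * (escape_rate p / 2) * s \<le> slope s" if s: "0 \<le> s" "s \<le> t" for s
  proof -
    have "slope 0 - \<eta> * (escape_rate p / 2) * 0 \<le> slope s - \<eta> * (escape_rate p / 2) * s"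
    proof (rule DERIV_nonneg_imp_increasing_open[OF s(1), of "\<lambda>s. slope s - \<eta> * (escape_rate p / 2) * s"])
      fix x assume x: "0 < x" "x < s"
      then have x1: "x < 1" "x \<le> t" using s t by auto
      obtain S where S: "(slope has_real_derivative S) (at x)"
        "S \<ge> \<eta> * (escape_rate p - weight x * h x powr (1 - p))" using deriv_slope[OF x(1) x1(1)] by blast
      have "\<eta> * (escape_rate p - weight x * h x powr (1 - p)) \<ge> \<eta> * (escape_rate p / 2)"
        using low_powr_le[of x] h_low[of x] x x1 \<eta> by (intro mult_left_mono) auto
      moreover have "((\<lambda>s. slope s - \<eta> * (escape_rate p / 2) * s) has_real_derivative S - \<eta> * (escape_rate p / 2)) (at x)"
        by (rule derivative_eq_intros S(1) refl | simp)+
      ultimately show "\<exists>y. ((\<lambda>s. slope s - \<eta> * (escape_rate p / 2) * s) has_real_derivative y) (at x) \<and> 0 \<le> y"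
        using S(2) by - (rule exI, rule conjI, assumption, linarith)
    qed (use s t in \<open>auto intro!: continuous_intros continuous_on_subset[OF cont_slope]\<close>)
    then show ?thesis by simp
  qed
  define c where "c = (1 - p) * escape_rate p * \<eta>\<^sup>2 / 4"
  have "h 0 powr (1 - p) - c * 0\<^sup>2 \<le> h t powr (1 - p) - c * t\<^sup>2"
  proof (rule DERIV_nonneg_imp_increasing_open[of 0 t "\<lambda>t. h t powr (1 - p) - c * t\<^sup>2"])
    show "continuous_on {0..t} (\<lambda>t. h t powr (1 - p) - c * t\<^sup>2)"
      using t pos by (intro continuous_intros continuous_on_powr continuous_on_subset[OF cont_h]) (force simp: less_le)+
    fix x assume x: "0 < x" "x < t"
    then have x1: "x < 1" "x \<le> t" using t by auto
    have hx: "h x > 0" using pos x x1 by simp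
    have "((\<lambda>t. h t powr (1 - p)) has_real_derivative (1 - p) * h x powr (1 - p - 1) * (\<eta> * v x)) (at x)"
      by (rule DERIV_chain2[OF has_real_derivative_powr[OF hx] dh'[OF x(1) x1(1)]])
    then have "((\<lambda>t. h t powr (1 - p)) has_real_derivative (1 - p) * \<eta> * slope x) (at x)"
      by (simp add: slope_def mult_ac)
    moreover have "((\<lambda>t. c * t\<^sup>2) has_real_derivative c * (2 * x)) (at x)"
      by (auto intro!: derivative_eq_intros)
    ultimately have "((\<lambda>t. h t powr (1 - p) - c * t\<^sup>2) has_real_derivative (1 - p) * \<eta> * slope x - c * (2 * x)) (at x)"
      by (rule DERIV_diff)
    note d = this
    have "(1 - p) * \<eta> * (\<eta> * (escape_rate p / 2) * x) \<le> (1 - p) * \<eta> * slope x"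
      using slope_ge[of x] x p \<eta> by (intro mult_left_mono) auto
    moreover have "c * (2 * x) = (1 - p) * \<eta> * (\<eta> * (escape_rate p / 2) * x)"
      by (simp add: c_def power2_eq_square)
    ultimately have "0 \<le> (1 - p) * \<eta> * slope x - c * (2 * x)" by linarith
    with d show "\<exists>y. ((\<lambda>t. h t powr (1 - p) - c * t\<^sup>2) has_real_derivative y) (at x) \<and> 0 \<le> y" by blast
  qed (use t in simp)
  moreover have "0 \<le> h 0 powr (1 - p)" by simp
  ultimately have "c * t\<^sup>2 \<le> h t powr (1 - p)" by (simp only: zero_power2)
  then show ?thesis by (simp add: c_def power_mult_distrib)
qed

end

section \<open>Orbits with a prescribed angle and their limits\<close>

lemma powr_lipschitz:
  fixes a b d p :: real
  assumes p: "0 < p" "p < 1" and d: "0 < d" "d \<le> a" "d \<le> b"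
  shows "\<bar>a powr p - b powr p\<bar> \<le> d powr (p - 1) * \<bar>a - b\<bar>"
proof -
  have *: "\<bar>y powr p - x powr p\<bar> \<le> d powr (p - 1) * \<bar>y - x\<bar>" if "d \<le> x" "x \<le> y" for x y
  proof -
    have x: "0 < x" using that d by simp
    have "(y / x) powr p \<le> 1 + p * (y / x - 1)" using x that p by (intro powr_le_linear) auto
    then have "x powr p * (y / x) powr p \<le> x powr p * (1 + p * (y / x - 1))" by (intro mult_left_mono) auto
    also have "x powr p * (y / x) powr p = y powr p" using x that by (simp add: powr_divide)
    also have "x powr p * (1 + p * (y / x - 1)) = x powr p + p * (x powr (p - 1) * (y - x))"
      using x by (simp add: powr_diff field_simps)
    finally have "y powr p - x powr p \<le> p * (x powr (p - 1) * (y - x))" by simp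
    also have "\<dots> \<le> 1 * (d powr (p - 1) * (y - x))"
    proof (intro mult_mono)
      show "x powr (p - 1) \<le> d powr (p - 1)" using that d p by (intro powr_mono2') auto
    qed (use that p in auto)
    finally show ?thesis using that x p powr_mono2[of p x y] by simp
  qed
  show ?thesis
  proof (cases "a \<le> b")
    case True then show ?thesis using *[of a b] d by (simp add: abs_minus_commute)
  next
    case False then show ?thesis using *[of b a] d by simp
  qed
qed

text \<open>At the first time with height \<epsilon> / 4 the energy is at least
  \<open>- (\<epsilon> / 4) powr (p + 1) / (p + 1)\<close>, but it started at no more than half of
  \<open>- \<epsilon> powr (p + 1) / (p + 1)\<close> and cannot increase; since
  \<open>4 powr (p + 1) > 2\<close>, this is impossible. So the truncation never acts and the orbit
  solves the original equation.\<close>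

lemma truncated_orbit_positive:
  fixes h v :: "real \<Rightarrow> real"
  assumes p: "0 < p" and \<sigma>: "0 < \<sigma>" and \<eta>: "0 \<le> \<eta>" "\<eta> powr \<sigma> \<le> 2" and \<epsilon>: "0 < \<epsilon>"
    and dh: "\<And>t. t \<in> {0..1} \<Longrightarrow> (h has_real_derivative \<eta> * v t) (at t within {0..1})"
    and dv: "\<And>t. t \<in> {0..1} \<Longrightarrow>
      (v has_real_derivative \<eta> * (max (h t) (\<epsilon> / 4) powr p - (\<eta> * (1 - t)) powr \<sigma> * h t)) (at t within {0..1})"
    and init: "h 0 = \<epsilon>" "v 0 = 0" and small: "2 * \<epsilon>\<^sup>2 \<le> \<epsilon> powr (p + 1) / (p + 1)"
    and t: "t \<in> {0..1}"
  shows "\<epsilon> / 4 < h t"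
proof (rule ccontr)
  assume not: "\<not> \<epsilon> / 4 < h t"
  have ch: "continuous_on {0..1} h" using dh DERIV_continuous continuous_on_eq_continuous_within by blast
  have cv: "continuous_on {0..1} v" using dv DERIV_continuous continuous_on_eq_continuous_within by blast
  define S where "S = {0..1} \<inter> h -` {..\<epsilon> / 4}"
  have "compact S" unfolding S_def compact_eq_bounded_closed
    by (auto intro!: continuous_closed_preimage ch)
  moreover have "S \<noteq> {}" using not t by (auto simp: S_def)
  ultimately obtain t1 where t1: "t1 \<in> S" "\<And>s. s \<in> S \<Longrightarrow> t1 \<le> s"
    using continuous_attains_inf[of S "\<lambda>x. x"] by (auto intro: continuous_on_id)
  have t1': "0 \<le> t1" "t1 \<le> 1" "h t1 \<le> \<epsilon> / 4" using t1(1) by (auto simp: S_def)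
  have above: "\<epsilon> / 4 < h s" if "0 \<le> s" "s < t1" for s
  proof (rule ccontr)
    assume "\<not> \<epsilon> / 4 < h s"
    then have "s \<in> S" using that t1' by (simp add: S_def)
    then show False using t1(2)[of s] that by simp
  qed
  have "\<exists>s. 0 \<le> s \<and> s \<le> t1 \<and> h s = \<epsilon> / 4"
    using t1' \<epsilon> init by (intro IVT2' continuous_on_subset[OF ch]) auto
  then have eq: "h t1 = \<epsilon> / 4" using above by (metis le_less less_irrefl)
  have pos: "h s > 0" if "0 \<le> s" "s \<le> t1" for s using above[of s] eq \<epsilon> that by (cases "s = t1") auto
  have "energy p ((\<eta> * (1 - t1)) powr \<sigma>) (h t1) (v t1) \<le> energy p (\<eta> powr \<sigma>) (h 0) (v 0)"
  proof (rule energy_antitone)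
    show "continuous_on {0..t1} h" "continuous_on {0..t1} v"
      using t1' by (auto intro: continuous_on_subset[OF ch] continuous_on_subset[OF cv])
    fix s assume s: "0 < s" "s < t1"
    then have "max (h s) (\<epsilon> / 4) = h s" using above[of s] by simp
    then show "(h has_real_derivative \<eta> * v s) (at s)"
      "(v has_real_derivative \<eta> * (h s powr p - (\<eta> * (1 - s)) powr \<sigma> * h s)) (at s)"
      using dh[of s] dv[of s] s t1' by (auto simp: at_within_Icc_at)
  qed (use p \<sigma> \<eta> t1' pos in auto)
  moreover have "\<eta> powr \<sigma> * \<epsilon>\<^sup>2 \<le> 2 * \<epsilon>\<^sup>2" using \<eta> by (intro mult_right_mono) auto
  moreover have "0 \<le> (v t1)\<^sup>2" "0 \<le> (\<eta> * (1 - t1)) powr \<sigma> * (h t1)\<^sup>2" by auto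
  ultimately have "\<epsilon> powr (p + 1) / (p + 1) \<le> 2 * ((\<epsilon> / 4) powr (p + 1) / (p + 1))"
    using small unfolding energy_def init eq by (simp only: zero_power2)
  then have le: "\<epsilon> powr (p + 1) \<le> 2 * (\<epsilon> / 4) powr (p + 1)" using p by (simp add: divide_le_cancel)
  have "4 powr 1 \<le> 4 powr (p + 1)" using p by (intro powr_mono) auto
  then have "(\<epsilon> / 4) powr (p + 1) \<le> \<epsilon> powr (p + 1) / 4"
    using \<epsilon> divide_left_mono[of 4 "4 powr (p + 1)" "\<epsilon> powr (p + 1)"] by (simp add: powr_divide)
  moreover have "0 < \<epsilon> powr (p + 1)" using \<epsilon> by simp
  ultimately show False using le by linarith
qed

lemma ex_orbit_with_angle:
  fixes p \<sigma> R C \<epsilon> J :: real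
  assumes p: "0 < p" "p < 1" and \<sigma>: "0 < \<sigma>"
    and R: "1 \<le> R" "R powr \<sigma> \<le> 2"
    and C: "energy_gap p \<le> C" "\<And>x. 0 \<le> x \<Longrightarrow> x powr (p + 1) / (p + 1) \<le> x\<^sup>2 / 4 + C"
    and drift: "8 * C * drift R \<sigma> R \<le> energy_gap p" "2 * drift R \<sigma> R \<le> ln 2"
    and \<epsilon>: "0 < \<epsilon>" "2 * \<epsilon>\<^sup>2 \<le> \<epsilon> powr (p + 1) / (p + 1)" "\<epsilon> powr (p + 1) / (p + 1) \<le> energy_gap p / 4"
    and J: "J \<le> 0" "(1 + 2 * sqrt (8 * C) powr (1 - p) - R * escape_rate p / 2) / rotation_deficit p C
     + drift_effect p C * drift R \<sigma> R \<le> J"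
  obtains \<eta> h v where "backward_orbit p \<sigma> R C \<eta> h v" "h 0 = \<epsilon>"
    "integral {0..1} (\<lambda>t. angular_rate p \<sigma> \<eta> t (h t) (v t)) = J"
proof -
  \<comment> \<open>Clamping \<eta> and t, and cutting the power off below \<epsilon> / 4, makes the
    right-hand side globally continuous and Lipschitz in x; on the rectangle the clamping changes
    nothing.\<close>
  define cR where "cR = (\<lambda>\<eta>. max 0 (min R \<eta>))"
  define c1 where "c1 = (\<lambda>t::real. max 0 (min 1 t))"
  have cR: "0 \<le> cR \<eta>" "cR \<eta> \<le> R" for \<eta> using R by (auto simp: cR_def)
  have c1: "0 \<le> c1 t" "c1 t \<le> 1" for t by (auto simp: c1_def)
  define G where "G \<eta> t x = max x (\<epsilon> / 4) powr p - (cR \<eta> * (1 - c1 t)) powr \<sigma> * x" for \<eta> t x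
  have V: "0 \<le> cR \<eta> * (1 - c1 t)" "cR \<eta> * (1 - c1 t) \<le> R" for \<eta> t
    using cR[of \<eta>] c1[of t] by (auto intro: order_trans[OF mult_left_le])
  have G_cont: "continuous_on UNIV (\<lambda>z. G (fst z) (fst (snd z)) (snd (snd z)))"
  proof -
    have 1: "continuous_on UNIV (\<lambda>z::real \<times> real \<times> real. max (snd (snd z)) (\<epsilon> / 4))"
      by (intro continuous_intros)
    have 2: "continuous_on UNIV (\<lambda>z::real \<times> real \<times> real. cR (fst z) * (1 - c1 (fst (snd z))))"
      unfolding cR_def c1_def by (intro continuous_intros)
    have 3: "continuous_on UNIV (\<lambda>z::real \<times> real \<times> real. max (snd (snd z)) (\<epsilon> / 4) powr p)"
      by (rule continuous_on_powr'[OF 1 continuous_on_const]) (use \<epsilon>(1) in auto)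
    have 4: "continuous_on UNIV (\<lambda>z::real \<times> real \<times> real. (cR (fst z) * (1 - c1 (fst (snd z)))) powr \<sigma>)"
      by (rule continuous_on_powr'[OF 2 continuous_on_const]) (use V(1) \<sigma> in simp)
    show ?thesis
      unfolding G_def by (intro continuous_on_diff continuous_on_mult 3 4 continuous_on_snd continuous_on_id)
  qed
  have G_lip: "\<bar>G \<eta> t x - G \<eta> t y\<bar> \<le> ((\<epsilon> / 4) powr (p - 1) + 2) * \<bar>x - y\<bar>" for \<eta> t x y
  proof -
    have "\<bar>max x (\<epsilon> / 4) powr p - max y (\<epsilon> / 4) powr p\<bar> \<le> (\<epsilon> / 4) powr (p - 1) * \<bar>max x (\<epsilon> / 4) - max y (\<epsilon> / 4)\<bar>"
      using \<epsilon> p by (intro powr_lipschitz) auto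
    also have "\<dots> \<le> (\<epsilon> / 4) powr (p - 1) * \<bar>x - y\<bar>" by (intro mult_left_mono) auto
    finally have 1: "\<bar>max x (\<epsilon> / 4) powr p - max y (\<epsilon> / 4) powr p\<bar> \<le> (\<epsilon> / 4) powr (p - 1) * \<bar>x - y\<bar>" .
    have "(cR \<eta> * (1 - c1 t)) powr \<sigma> \<le> 2"
      using powr_mono2[OF _ V, of \<sigma>] \<sigma> R by (meson order_trans less_imp_le)
    then have "(cR \<eta> * (1 - c1 t)) powr \<sigma> * \<bar>x - y\<bar> \<le> 2 * \<bar>x - y\<bar>" by (intro mult_right_mono) auto
    then have 2: "\<bar>(cR \<eta> * (1 - c1 t)) powr \<sigma> * x - (cR \<eta> * (1 - c1 t)) powr \<sigma> * y\<bar> \<le> 2 * \<bar>x - y\<bar>"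
      by (simp add: abs_mult flip: right_diff_distrib)
    show ?thesis using 1 2 unfolding G_def distrib_right by linarith
  qed
  have R0: "0 \<le> R" and L0: "0 \<le> (\<epsilon> / 4) powr (p - 1) + 2" using R by auto
  obtain h v where hv:
    "continuous_on ({0..R} \<times> {0..1}) (\<lambda>z. h (fst z) (snd z))"
    "continuous_on ({0..R} \<times> {0..1}) (\<lambda>z. v (fst z) (snd z))"
    "\<And>\<eta>. \<eta> \<in> {0..R} \<Longrightarrow> h \<eta> 0 = \<epsilon>" "\<And>\<eta>. \<eta> \<in> {0..R} \<Longrightarrow> v \<eta> 0 = 0"
    "\<And>\<eta> \<tau>. \<eta> \<in> {0..R} \<Longrightarrow> \<tau> \<in> {0..1} \<Longrightarrow> (h \<eta> has_real_derivative \<eta> * v \<eta> \<tau>) (at \<tau> within {0..1})"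
    "\<And>\<eta> \<tau>. \<eta> \<in> {0..R} \<Longrightarrow> \<tau> \<in> {0..1} \<Longrightarrow>
       (v \<eta> has_real_derivative \<eta> * G \<eta> \<tau> (h \<eta> \<tau>)) (at \<tau> within {0..1})"
    by (rule second_order_ivp_param[OF R0 L0 G_cont G_lip, of \<epsilon>]) (rule that; assumption)
  have G_eq: "G \<eta> t x = max x (\<epsilon> / 4) powr p - (\<eta> * (1 - t)) powr \<sigma> * x"
    if "\<eta> \<in> {0..R}" "t \<in> {0..1}" for \<eta> t x using that by (simp add: G_def cR_def c1_def)
  have above: "\<epsilon> / 4 < h \<eta> t" if "\<eta> \<in> {0..R}" "t \<in> {0..1}" for \<eta> t
  proof (rule truncated_orbit_positive[OF p(1) \<sigma> _ _ \<epsilon>(1) _ _ _ _ \<epsilon>(2) that(2)])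
    show "\<eta> powr \<sigma> \<le> 2" using powr_mono2[of \<sigma> \<eta> R] that \<sigma> R by auto
    show "h \<eta> 0 = \<epsilon>" "v \<eta> 0 = 0" "0 \<le> \<eta>" using hv that by auto
  qed (use hv(5,6) G_eq that in auto)
  have orbit: "backward_orbit p \<sigma> R C \<eta> (h \<eta>) (v \<eta>)" if "\<eta> \<in> {0..R}" for \<eta>
  proof
    fix t :: real assume t: "t \<in> {0..1}"
    have "max (h \<eta> t) (\<epsilon> / 4) = h \<eta> t" using above[OF that t] by simp
    then show "(v \<eta> has_real_derivative \<eta> * (h \<eta> t powr p - (\<eta> * (1 - t)) powr \<sigma> * h \<eta> t)) (at t within {0..1})"
      using hv(6)[OF that t] G_eq[OF that t] by simp
    show "0 < h \<eta> t" using above[OF that t] \<epsilon> by simp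
    show "(h \<eta> has_real_derivative \<eta> * v \<eta> t) (at t within {0..1})" using hv(5)[OF that t] .
  qed (use p \<sigma> R C drift that hv(3,4)[OF that] \<epsilon> in auto)
  define f where "f \<eta> = integral (cbox 0 1) (\<lambda>t. angular_rate p \<sigma> \<eta> t (h \<eta> t) (v \<eta> t))" for \<eta>
  have "continuous_on {0..R} f"
    unfolding f_def
  proof (rule integral_continuous_on_param)
    have nz: "(h (fst z) (snd z) - 1)\<^sup>2 + (v (fst z) (snd z))\<^sup>2 \<noteq> 0" if "z \<in> {0..R} \<times> {0..1}" for z
      using backward_orbit.dist_pos[OF orbit[of "fst z"], of "snd z"] that by (auto simp: less_le)
    have "continuous_on ({0..R} \<times> {0..1}) (\<lambda>z. (fst z * (1 - snd z)) powr \<sigma>)"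
      by (rule continuous_on_powr') (use \<sigma> in \<open>auto intro!: continuous_intros\<close>)
    moreover have "continuous_on ({0..R} \<times> {0..1}) (\<lambda>z. h (fst z) (snd z) powr p)"
    proof (rule continuous_on_powr'[OF hv(1) continuous_on_const], intro ballI)
      fix z :: "real \<times> real" assume "z \<in> {0..R} \<times> {0..1}"
      then show "0 \<le> h (fst z) (snd z) \<and> (h (fst z) (snd z) = 0 \<longrightarrow> 0 < p)"
        using above[of "fst z" "snd z"] \<epsilon>(1) p(1) by (auto simp: mem_Times_iff)
    qed
    ultimately have "continuous_on ({0..R} \<times> {0..1}) (\<lambda>z. angular_rate p \<sigma> (fst z) (snd z) (h (fst z) (snd z)) (v (fst z) (snd z)))"
      unfolding angular_rate_def using hv(1,2) nz
      by (intro continuous_on_divide continuous_on_mult continuous_on_diff continuous_on_add continuous_on_power continuous_on_const continuous_on_fst continuous_on_id ballI) assumption+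
    then show "continuous_on ({0..R} \<times> cbox 0 1) (\<lambda>(\<eta>, t). angular_rate p \<sigma> \<eta> t (h \<eta> t) (v \<eta> t))"
      by (simp add: split_beta cbox_interval)
  qed
  moreover have "f R \<le> J"
    using backward_orbit.angle_le[OF orbit[of R]] backward_orbit.angle_def[OF orbit[of R]] R J(2)
    by (simp add: f_def)
  moreover have "J \<le> f 0" using J(1) by (simp add: f_def angular_rate_def)
  ultimately obtain \<eta> where \<eta>: "0 \<le> \<eta>" "\<eta> \<le> R" "f \<eta> = J"
    using IVT2'[of f R J 0] R by auto
  show ?thesis using that[OF orbit[of \<eta>]] hv(3)[of \<eta>] \<eta> by (simp add: f_def)
qed

section \<open>Equicontinuity and passage to the limit\<close>

context backward_orbit
begin

lemma lipschitz_h: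
  assumes "x \<in> {0..1}" "y \<in> {0..1}"
  shows "\<bar>h x - h y\<bar> \<le> R * sqrt (8 * C) * \<bar>x - y\<bar>"
proof -
  have "norm (\<eta> * v z) \<le> R * sqrt (8 * C)" if "z \<in> {0..1}" for z
    using abs_v_le[OF that] \<eta> M_pos unfolding real_norm_def abs_mult by (intro mult_mono) auto
  then show ?thesis
    using field_differentiable_bound[OF convex_closed_interval dh, of "R * sqrt (8 * C)" x y] assms by simp
qed

lemma abs_force_le:
  assumes t: "t \<in> {0..1}"
  shows "\<bar>\<eta> * (h t powr p - weight t * h t)\<bar> \<le> R * (sqrt (8 * C) powr p + 2 * sqrt (8 * C))"
proof -
  have "\<bar>weight t * h t\<bar> \<le> 2 * sqrt (8 * C)"
    unfolding abs_mult using weight_range[OF t] h_le[OF t] pos[OF t] by (intro mult_mono) auto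
  moreover have "\<bar>h t powr p\<bar> \<le> sqrt (8 * C) powr p"
    using h_le[OF t] pos[OF t] p by (auto intro!: powr_mono2)
  ultimately have "\<bar>h t powr p - weight t * h t\<bar> \<le> sqrt (8 * C) powr p + 2 * sqrt (8 * C)" by linarith
  then show ?thesis unfolding abs_mult using \<eta> by (intro mult_mono) auto
qed

lemma lipschitz_v:
  assumes "x \<in> {0..1}" "y \<in> {0..1}"
  shows "\<bar>v x - v y\<bar> \<le> R * (sqrt (8 * C) powr p + 2 * sqrt (8 * C)) * \<bar>x - y\<bar>"
  using field_differentiable_bound[OF convex_closed_interval dv, of "R * (sqrt (8 * C) powr p + 2 * sqrt (8 * C))" x y]
    abs_force_le assms by (simp add: weight_def)

lemma abs_angular_rate_le:
  assumes t: "t \<in> {0..1}"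
  shows "\<bar>angular_rate p \<sigma> \<eta> t (h t) (v t)\<bar> \<le>
    ((sqrt (8 * C) + 1) * (R * (sqrt (8 * C) powr p + 2 * sqrt (8 * C))) + R * (8 * C)) / energy_gap p"
proof -
  have "\<bar>(h t - 1) * (\<eta> * (h t powr p - weight t * h t))\<bar> \<le> (sqrt (8 * C) + 1) * (R * (sqrt (8 * C) powr p + 2 * sqrt (8 * C)))"
    unfolding abs_mult[of "h t - 1"] using h_le[OF t] pos[OF t] abs_force_le[OF t] by (intro mult_mono) auto
  moreover have "\<bar>\<eta> * (v t)\<^sup>2\<bar> \<le> R * (8 * C)"
    unfolding abs_mult using \<eta> bounds(2)[OF t] by (intro mult_mono) auto
  ultimately have "\<bar>(h t - 1) * (\<eta> * (h t powr p - weight t * h t)) - \<eta> * (v t)\<^sup>2\<bar>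
    \<le> (sqrt (8 * C) + 1) * (R * (sqrt (8 * C) powr p + 2 * sqrt (8 * C))) + R * (8 * C)" by linarith
  then have "\<bar>(h t - 1) * (\<eta> * (h t powr p - weight t * h t)) - \<eta> * (v t)\<^sup>2\<bar> / ((h t - 1)\<^sup>2 + (v t)\<^sup>2)
    \<le> ((sqrt (8 * C) + 1) * (R * (sqrt (8 * C) powr p + 2 * sqrt (8 * C))) + R * (8 * C)) / energy_gap p"
    using away_from_equilibrium[OF t] gap_pos by (intro frac_le) auto
  moreover have "angular_rate p \<sigma> \<eta> t (h t) (v t) = ((h t - 1) * (\<eta> * (h t powr p - weight t * h t)) - \<eta> * (v t)\<^sup>2) / ((h t - 1)\<^sup>2 + (v t)\<^sup>2)"
    by (simp add: angular_rate_def weight_def algebra_simps)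
  ultimately show ?thesis by (simp add: abs_divide)
qed

end

text \<open>The equation passes to the limit in integrated form by dominated convergence, and the
  continuity of \<open>g\<close> allows differentiating it back. Pointwise convergence under a
  common bound is enough.\<close>

lemma integral_equation_limit:
  fixes u f :: "nat \<Rightarrow> real \<Rightarrow> real"
  assumes du: "\<And>n t. t \<in> {0..1} \<Longrightarrow> (u n has_real_derivative f n t) (at t within {0..1})"
    and bound: "\<And>n t. t \<in> {0..1} \<Longrightarrow> \<bar>f n t\<bar> \<le> B"
    and lim_u: "\<And>t. t \<in> {0..1} \<Longrightarrow> (\<lambda>n. u n t) \<longlonglongrightarrow> w t"
    and lim_f: "\<And>t. t \<in> {0..1} \<Longrightarrow> (\<lambda>n. f n t) \<longlonglongrightarrow> g t"
    and cg: "continuous_on {0..1} g" and t: "t \<in> {0..1}"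
  shows "(w has_real_derivative g t) (at t within {0..1})"
proof -
  have eq: "w s = w 0 + integral {0..s} g" if s: "s \<in> {0..1}" for s
  proof -
    have hi: "(f n has_integral u n s - u n 0) {0..s}" for n
    proof (rule fundamental_theorem_of_calculus)
      fix x assume "x \<in> {0..s}"
      then show "(u n has_vector_derivative f n x) (at x within {0..s})"
        using du[of x n] s has_real_derivative_iff_has_vector_derivative
        by (auto intro: has_vector_derivative_within_subset)
    qed (use s in simp)
    have "(\<lambda>n. integral {0..s} (f n)) \<longlonglongrightarrow> integral {0..s} g"
    proof (rule dominated_convergence(2)[where h = "\<lambda>_. B"])
      show "f n integrable_on {0..s}" for n using hi by blast
    qed (use bound lim_f s in auto)
    moreover have "integral {0..s} (f n) = u n s - u n 0" for n using hi by (rule integral_unique)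
    moreover have "(\<lambda>n. u n s - u n 0) \<longlonglongrightarrow> w s - w 0" using lim_u[OF s] lim_u[of 0] by (intro tendsto_diff) auto
    ultimately have "integral {0..s} g = w s - w 0" using LIMSEQ_unique by auto
    then show ?thesis by simp
  qed
  have "((\<lambda>s. w 0 + integral {0..s} g) has_real_derivative g t) (at t within {0..1})"
    using DERIV_add[OF DERIV_const integral_has_real_derivative[OF cg t]] by simp
  then show ?thesis
    by (rule has_field_derivative_transform_within[OF _ zero_less_one t]) (rule eq[symmetric])
qed

text \<open>The equation, \<open>v 1 = 0\<close>, the angle and the growth bound are closed
  conditions. The angle converges because its denominators stay above \<open>energy_gap p\<close>.
  Strict positivity is not closed; the last conclusion, the limit of \<open>growth\<close>, is its
  substitute.\<close>

lemma limit_orbit: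
  fixes \<epsilon> \<eta> :: "nat \<Rightarrow> real" and h v :: "nat \<Rightarrow> real \<Rightarrow> real"
  assumes orbit: "\<And>n. backward_orbit p \<sigma> R C (\<eta> n) (h n) (v n)"
    and init: "\<And>n. h n 0 = \<epsilon> n" and lim: "\<epsilon> \<longlonglongrightarrow> 0"
    and angle: "\<And>n. integral {0..1} (\<lambda>t. angular_rate p \<sigma> (\<eta> n) t (h n t) (v n t)) = - real j * pi"
  obtains \<eta>' h' v' where "\<eta>' \<in> {0..R}"
    "\<And>t. t \<in> {0..1} \<Longrightarrow> (h' has_real_derivative \<eta>' * v' t) (at t within {0..1})"
    "\<And>t. t \<in> {0..1} \<Longrightarrow> (v' has_real_derivative \<eta>' * (h' t powr p - (\<eta>' * (1 - t)) powr \<sigma> * h' t)) (at t within {0..1})"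
    "\<And>t. t \<in> {0..1} \<Longrightarrow> 0 \<le> h' t" "h' 0 = 0" "v' 0 = 0" "v' 1 = 0"
    "integral {0..1} (\<lambda>t. angular_rate p \<sigma> \<eta>' t (h' t) (v' t)) = - real j * pi"
    "\<And>t. t \<in> {0..1} \<Longrightarrow> \<eta>' * t * sqrt (8 * C) < low_height p / 2 \<Longrightarrow>
      (1 - p) * escape_rate p * (\<eta>' * t)\<^sup>2 / 4 \<le> h' t powr (1 - p)"
proof -
  note orb = backward_orbit.p[OF orbit] backward_orbit.\<sigma>[OF orbit] backward_orbit.R[OF orbit]
  have \<eta>: "0 \<le> \<eta> n" "\<eta> n \<le> R" for n using backward_orbit.\<eta>[OF orbit] .
  have p: "0 < p" "p < 1" and \<sigma>: "0 < \<sigma>" and R: "1 \<le> R" using orb by auto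
  define M where "M = sqrt (8 * C)"
  have M: "M > 0" unfolding M_def by (rule backward_orbit.M_pos[OF orbit[of 0]])
  define N where "N = M powr p + 2 * M"
  have N: "N > 0" using M by (simp add: N_def add_nonneg_pos)
  \<comment> \<open>With the parameter bundled into the orbit, one application of Arzela-Ascoli
    extracts a subsequence for both.\<close>
  define F where "F n t = (\<eta> n, h n t, v n t)" for n t
  have F_bound: "norm (F n t) \<le> R + (M + M)" if t: "t \<in> {0..1}" for n t
  proof -
    have "\<bar>h n t\<bar> \<le> M" "\<bar>v n t\<bar> \<le> M"
      using backward_orbit.h_le[OF orbit t] backward_orbit.pos[OF orbit t, of n] backward_orbit.abs_v_le[OF orbit t]
      by (auto simp: M_def)
    moreover have "norm (F n t) \<le> norm (\<eta> n) + (norm (h n t) + norm (v n t))"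
      unfolding F_def by (intro order_trans[OF norm_Pair_le] add_mono order_refl norm_Pair_le)
    ultimately show ?thesis using \<eta>[of n] by simp
  qed
  have F_lip: "norm (F n x - F n y) \<le> (R * M + R * N) * \<bar>x - y\<bar>" if "x \<in> {0..1}" "y \<in> {0..1}" for n x y
  proof -
    have "norm (F n x - F n y) \<le> norm (\<eta> n - \<eta> n) + (norm (h n x - h n y) + norm (v n x - v n y))"
      unfolding F_def diff_Pair by (intro order_trans[OF norm_Pair_le] add_mono order_refl norm_Pair_le)
    also have "\<dots> \<le> 0 + (R * M * \<bar>x - y\<bar> + R * N * \<bar>x - y\<bar>)"
      using backward_orbit.lipschitz_h[OF orbit that] backward_orbit.lipschitz_v[OF orbit that]
      by (intro add_mono) (auto simp: M_def N_def)
    finally show ?thesis by (simp add: algebra_simps)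
  qed
  obtain g k where g: "continuous_on {0..1} g" and k: "strict_mono (k :: nat \<Rightarrow> nat)"
    and conv: "\<And>e. 0 < e \<Longrightarrow> \<exists>N. \<forall>n x. n \<ge> N \<and> x \<in> {0..1} \<longrightarrow> norm (F (k n) x - g x) < e"
  proof (rule Arzela_Ascoli[of "{0..1::real}" F "R + (M + M)"])
    define L where "L = R * M + R * N"
    have L: "L > 0" using R M N by (auto simp: L_def intro!: add_pos_pos)
    show "\<exists>d>0. \<forall>n y. y \<in> {0..1} \<and> norm (x - y) < d \<longrightarrow> norm (F n x - F n y) < e"
      if x: "x \<in> {0..1}" and e: "0 < e" for x e
    proof (intro exI conjI allI impI)
      show "0 < e / L" using e L by simp
      fix n y assume y: "y \<in> {0..1} \<and> norm (x - y) < e / L"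
      have "norm (F n x - F n y) \<le> L * \<bar>x - y\<bar>" using F_lip[OF x, of y n] y by (simp add: L_def)
      also have "\<dots> < L * (e / L)" using y L by (intro mult_strict_left_mono) auto
      finally show "norm (F n x - F n y) < e" using L by simp
    qed
  qed (use F_bound in auto)
  have lim_F: "(\<lambda>n. F (k n) t) \<longlonglongrightarrow> g t" if "t \<in> {0..1}" for t
    unfolding LIMSEQ_iff using conv that by meson
  define \<eta>' where "\<eta>' = fst (g 0)"
  define h' where "h' t = fst (snd (g t))" for t
  define v' where "v' t = snd (snd (g t))" for t
  have lim_\<eta>: "(\<lambda>n. \<eta> (k n)) \<longlonglongrightarrow> \<eta>'"
    using tendsto_fst[OF lim_F[of 0]] by (simp add: F_def \<eta>'_def)
  have lim_h: "(\<lambda>n. h (k n) t) \<longlonglongrightarrow> h' t" if "t \<in> {0..1}" for t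
    using tendsto_fst[OF tendsto_snd[OF lim_F[OF that]]] by (simp add: F_def h'_def)
  have lim_v: "(\<lambda>n. v (k n) t) \<longlonglongrightarrow> v' t" if "t \<in> {0..1}" for t
    using tendsto_snd[OF tendsto_snd[OF lim_F[OF that]]] by (simp add: F_def v'_def)
  have ch: "continuous_on {0..1} h'" and cv: "continuous_on {0..1} v'"
    unfolding h'_def v'_def by (intro continuous_intros g)+
  have \<eta>': "0 \<le> \<eta>'" "\<eta>' \<le> R"
    using LIMSEQ_le_const[OF lim_\<eta>] LIMSEQ_le_const2[OF lim_\<eta>] \<eta> by blast+
  have h'0: "0 \<le> h' t" if "t \<in> {0..1}" for t
    using LIMSEQ_le_const[OF lim_h[OF that]] backward_orbit.pos[OF orbit that] by (meson less_imp_le)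
  have lim_hp: "(\<lambda>n. h (k n) t powr q) \<longlonglongrightarrow> h' t powr q" if "t \<in> {0..1}" "0 < q" for t q
    using that backward_orbit.pos[OF orbit that(1)]
    by (intro tendsto_powr' lim_h tendsto_const) (auto simp: less_imp_le)
  have lim_w: "(\<lambda>n. (\<eta> (k n) * (1 - t)) powr \<sigma>) \<longlonglongrightarrow> (\<eta>' * (1 - t)) powr \<sigma>" if "t \<in> {0..1}" for t
    using that \<sigma> \<eta> by (intro tendsto_powr' tendsto_mult lim_\<eta> tendsto_const) auto
  have lim_force: "(\<lambda>n. \<eta> (k n) * (h (k n) t powr p - (\<eta> (k n) * (1 - t)) powr \<sigma> * h (k n) t)) \<longlonglongrightarrow>
      \<eta>' * (h' t powr p - (\<eta>' * (1 - t)) powr \<sigma> * h' t)" if "t \<in> {0..1}" for t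
    by (intro tendsto_intros lim_\<eta> lim_hp lim_w lim_h that p)
  have dh: "(h' has_real_derivative \<eta>' * v' t) (at t within {0..1})" if t: "t \<in> {0..1}" for t
  proof (rule integral_equation_limit[where u = "\<lambda>n. h (k n)" and f = "\<lambda>n s. \<eta> (k n) * v (k n) s"
        and g = "\<lambda>s. \<eta>' * v' s" and B = "R * M", OF _ _ _ _ _ t])
    show "(h (k n) has_real_derivative \<eta> (k n) * v (k n) s) (at s within {0..1})" if "s \<in> {0..1}" for n s
      by (rule backward_orbit.dh[OF orbit that])
    show "\<bar>\<eta> (k n) * v (k n) s\<bar> \<le> R * M" if "s \<in> {0..1}" for n s
      unfolding abs_mult using \<eta>[of "k n"] backward_orbit.abs_v_le[OF orbit that] R
      by (intro mult_mono) (auto simp: M_def)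
    show "(\<lambda>n. \<eta> (k n) * v (k n) s) \<longlonglongrightarrow> \<eta>' * v' s" if "s \<in> {0..1}" for s
      by (intro tendsto_mult lim_\<eta> lim_v that)
    show "continuous_on {0..1} (\<lambda>s. \<eta>' * v' s)" by (intro continuous_intros cv)
  qed (rule lim_h)
  have dv: "(v' has_real_derivative \<eta>' * (h' t powr p - (\<eta>' * (1 - t)) powr \<sigma> * h' t)) (at t within {0..1})"
    if t: "t \<in> {0..1}" for t
  proof (rule integral_equation_limit[where u = "\<lambda>n. v (k n)"
        and f = "\<lambda>n s. \<eta> (k n) * (h (k n) s powr p - (\<eta> (k n) * (1 - s)) powr \<sigma> * h (k n) s)"
        and g = "\<lambda>s. \<eta>' * (h' s powr p - (\<eta>' * (1 - s)) powr \<sigma> * h' s)" and B = "R * N", OF _ _ _ _ _ t])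
    show "(v (k n) has_real_derivative \<eta> (k n) * (h (k n) s powr p - (\<eta> (k n) * (1 - s)) powr \<sigma> * h (k n) s)) (at s within {0..1})"
      if "s \<in> {0..1}" for n s
      by (rule backward_orbit.dv[OF orbit that])
    show "\<bar>\<eta> (k n) * (h (k n) s powr p - (\<eta> (k n) * (1 - s)) powr \<sigma> * h (k n) s)\<bar> \<le> R * N" if "s \<in> {0..1}" for n s
      using backward_orbit.abs_force_le[OF orbit that, of "k n"]
      by (simp add: N_def M_def backward_orbit.weight_def[OF orbit])
    have "continuous_on {0..1} (\<lambda>s. h' s powr p)"
      using h'0 p by (intro continuous_on_powr' ch continuous_on_const) auto
    then show "continuous_on {0..1} (\<lambda>s. \<eta>' * (h' s powr p - (\<eta>' * (1 - s)) powr \<sigma> * h' s))"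
      using \<sigma> \<eta>' ch by (intro continuous_on_mult continuous_on_diff continuous_on_weight continuous_on_const) auto
  qed (rule lim_v lim_force, assumption)+
  have angle': "integral {0..1} (\<lambda>t. angular_rate p \<sigma> \<eta>' t (h' t) (v' t)) = - real j * pi"
  proof -
    define B where "B = ((M + 1) * (R * (M powr p + 2 * M)) + R * (8 * C)) / energy_gap p"
    have "(\<lambda>n. integral {0..1} (\<lambda>t. angular_rate p \<sigma> (\<eta> (k n)) t (h (k n) t) (v (k n) t)))
       \<longlonglongrightarrow> integral {0..1} (\<lambda>t. angular_rate p \<sigma> \<eta>' t (h' t) (v' t))"
    proof (rule dominated_convergence(2)[where h = "\<lambda>_. B"])
      show "(\<lambda>t. angular_rate p \<sigma> (\<eta> (k n)) t (h (k n) t) (v (k n) t)) integrable_on {0..1}" for n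
        by (intro integrable_continuous_real backward_orbit.cont_angular_rate[OF orbit])
      show "norm (angular_rate p \<sigma> (\<eta> (k n)) t (h (k n) t) (v (k n) t)) \<le> B" if "t \<in> {0..1}" for n t
        using backward_orbit.abs_angular_rate_le[OF orbit that] by (simp add: B_def M_def)
      show "(\<lambda>n. angular_rate p \<sigma> (\<eta> (k n)) t (h (k n) t) (v (k n) t)) \<longlonglongrightarrow> angular_rate p \<sigma> \<eta>' t (h' t) (v' t)"
        if t: "t \<in> {0..1}" for t
      proof -
        have r: "(\<lambda>n. (h (k n) t - 1)\<^sup>2 + (v (k n) t)\<^sup>2) \<longlonglongrightarrow> (h' t - 1)\<^sup>2 + (v' t)\<^sup>2"
          by (intro tendsto_intros lim_h lim_v t)
        have "energy_gap p \<le> (h' t - 1)\<^sup>2 + (v' t)\<^sup>2"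
          using LIMSEQ_le_const[OF r] backward_orbit.away_from_equilibrium[OF orbit t] by blast
        then have nz: "(h' t - 1)\<^sup>2 + (v' t)\<^sup>2 \<noteq> 0"
          using backward_orbit.gap_pos[OF orbit[of 0]] by linarith
        show ?thesis unfolding angular_rate_def
          by (intro tendsto_divide[OF _ r nz] tendsto_intros lim_\<eta> lim_hp lim_w lim_h lim_v t p)
      qed
    qed (rule integrable_const_ivl)
    then have "(\<lambda>n::nat. - real j * pi) \<longlonglongrightarrow> integral {0..1} (\<lambda>t. angular_rate p \<sigma> \<eta>' t (h' t) (v' t))"
      unfolding angle .
    then show ?thesis by (rule LIMSEQ_unique) (rule tendsto_const)
  qed
  have lim_\<epsilon>: "(\<lambda>n. \<epsilon> (k n)) \<longlonglongrightarrow> 0"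
    using LIMSEQ_subseq_LIMSEQ[OF lim k] by (simp add: o_def)
  show ?thesis
  proof (rule that[of \<eta>' h' v'])
    show "\<eta>' \<in> {0..R}" using \<eta>' by simp
    show "h' 0 = 0" using LIMSEQ_unique[OF lim_h[of 0], unfolded init, OF _ lim_\<epsilon>] by simp
    show "v' 0 = 0" using LIMSEQ_unique[OF lim_v[of 0], of 0] by (simp add: backward_orbit.v0[OF orbit])
    have "v n 1 = 0" for n
      using backward_orbit.stationary_at_half_turns[OF orbit] angle by (simp add: backward_orbit.angle_def[OF orbit])
    then show "v' 1 = 0" using LIMSEQ_unique[OF lim_v[of 1], of 0] by simp
    \<comment> \<open>The strict inequality at the limit carries over to all late orbits, so
      \<open>growth\<close> applies to them.\<close>
    fix t :: real assume t: "t \<in> {0..1}" and low: "\<eta>' * t * sqrt (8 * C) < low_height p / 2"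
    have l1: "(\<lambda>n. (1 - p) * escape_rate p * (\<eta> (k n) * t)\<^sup>2 / 4) \<longlonglongrightarrow> (1 - p) * escape_rate p * (\<eta>' * t)\<^sup>2 / 4"
      by (intro tendsto_intros lim_\<eta>) simp
    have l2: "(\<lambda>n. h (k n) t powr (1 - p)) \<longlonglongrightarrow> h' t powr (1 - p)" by (rule lim_hp[OF t]) (use p in simp)
    have l3: "(\<lambda>n. \<eta> (k n) * t * sqrt (8 * C)) \<longlonglongrightarrow> \<eta>' * t * sqrt (8 * C)"
      by (intro tendsto_intros lim_\<eta>)
    have "\<forall>\<^sub>F n in sequentially. \<eta> (k n) * t * sqrt (8 * C) < low_height p / 2"
      using order_tendstoD(2)[OF l3 low] .
    moreover have "\<forall>\<^sub>F n in sequentially. \<epsilon> (k n) < low_height p / 2"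
      using order_tendstoD(2)[OF lim_\<epsilon>, of "low_height p / 2"] low_height_range[OF p] by simp
    ultimately have "\<forall>\<^sub>F n in sequentially. (1 - p) * escape_rate p * (\<eta> (k n) * t)\<^sup>2 / 4 \<le> h (k n) t powr (1 - p)"
      by eventually_elim (rule backward_orbit.growth[OF orbit t], auto simp: init)
    then show "(1 - p) * escape_rate p * (\<eta>' * t)\<^sup>2 / 4 \<le> h' t powr (1 - p)"
      using tendsto_le[OF sequentially_bot l2 l1] by simp
  qed (rule angle' | (rule dh dv h'0, assumption))+
qed

section \<open>Rigidity of solutions between two zeros\<close>

lemma deriv_powr_nonneg:
  fixes x q :: real
  assumes "0 \<le> x" "1 < q"
  shows "((\<lambda>x. x powr q) has_real_derivative q * x powr (q - 1)) (at x within {0..})"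
proof (cases "x = 0")
  case False
  then show ?thesis using assms by (auto intro!: has_field_derivative_at_within has_real_derivative_powr)
next
  case True
  have "((\<lambda>y::real. y powr (q - 1)) \<longlongrightarrow> 0 powr (q - 1)) (at 0 within {0..})"
    by (intro tendsto_powr' tendsto_ident_at tendsto_const) (use assms in \<open>auto simp: eventually_at_filter\<close>)
  then have "((\<lambda>y::real. y powr (q - 1)) \<longlongrightarrow> 0) (at 0 within {0..})" using assms by simp
  then have "((\<lambda>y::real. (y powr q - 0 powr q) / (y - 0)) \<longlongrightarrow> 0) (at 0 within {0..})"
  proof (rule Lim_transform_eventually)
    have "y powr (q - 1) = (y powr q - 0 powr q) / (y - 0)" if "0 < y" for y :: real
      using that assms powr_diff[of y q 1] by simp
    then show "\<forall>\<^sub>F y::real in at 0 within {0..}. y powr (q - 1) = (y powr q - 0 powr q) / (y - 0)"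
      unfolding eventually_at_filter by (intro always_eventually) (simp add: less_le)
  qed
  then show ?thesis using True by (simp add: has_field_derivative_iff)
qed

text \<open>The monotone energy \<open>e\<close> is nonnegative at any zero of \<open>g\<close> and
  is 0 at the double zero b, so it is 0 in between; then its derivative, a positive multiple of the
  square of \<open>g\<close>, vanishes too. This serves both to exclude (P2) and to show positivity
  of the limit orbits, with different coefficients \<open>c\<close>.\<close>

lemma solution_vanishes_between_zeros:
  fixes g g1 :: "real \<Rightarrow> real"
  assumes p: "0 < p" and c: "0 \<le> c" and \<sigma>: "0 < \<sigma>" and ab: "0 \<le> a" "a < b"
    and dg: "\<And>\<xi>. a < \<xi> \<Longrightarrow> \<xi> < b \<Longrightarrow> (g has_real_derivative g1 \<xi>) (at \<xi>)"
    and dg1: "\<And>\<xi>. a < \<xi> \<Longrightarrow> \<xi> < b \<Longrightarrow> (g1 has_real_derivative c * g \<xi> powr p - \<xi> powr \<sigma> * g \<xi>) (at \<xi>)"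
    and cont: "continuous_on {a..b} g" "continuous_on {a..b} g1"
    and nonneg: "\<And>\<xi>. a \<le> \<xi> \<Longrightarrow> \<xi> \<le> b \<Longrightarrow> 0 \<le> g \<xi>"
    and zeros: "g a = 0" "g b = 0" "g1 b = 0" and \<xi>: "a < \<xi>" "\<xi> < b"
  shows "g \<xi> = 0"
proof -
  define e where "e \<xi> = (g1 \<xi>)\<^sup>2 / 2 - c * (g \<xi> powr (p + 1) / (p + 1)) + \<xi> powr \<sigma> * ((g \<xi>)\<^sup>2 / 2)" for \<xi>
  have de: "(e has_real_derivative \<sigma> * x powr (\<sigma> - 1) * ((g x)\<^sup>2 / 2)) (at x)" if x: "a < x" "x < b" for x
  proof -
    have at: "at x within {a<..<b} = at x" by (rule at_within_open) (use x in auto)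
    have sub: "g ` {a<..<b} \<subseteq> {0..}" using nonneg by auto
    \<comment> \<open>\<open>g\<close> may vanish here, so the power is differentiated within the
      nonnegative half-line and the chain rule is taken over the image of \<open>g\<close>.\<close>
    have "((\<lambda>y. y powr (p + 1)) has_real_derivative (p + 1) * g x powr (p + 1 - 1)) (at (g x) within g ` {a<..<b})"
      by (rule DERIV_subset[OF deriv_powr_nonneg sub]) (use nonneg x p in auto)
    from DERIV_image_chain[OF this, of "g1 x"] dg[OF x]
    have "((\<lambda>y. g y powr (p + 1)) has_real_derivative (p + 1) * g x powr p * g1 x) (at x)"
      by (simp add: at o_def)
    from DERIV_cdivide[OF this, of "p + 1"]
    have d1: "((\<lambda>y. g y powr (p + 1) / (p + 1)) has_real_derivative g x powr p * g1 x) (at x)"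
      using p by simp
    have d2: "((\<lambda>y. y powr \<sigma>) has_real_derivative \<sigma> * x powr (\<sigma> - 1)) (at x)"
      using x ab by (intro has_real_derivative_powr) auto
    have "(e has_real_derivative g1 x * (c * g x powr p - x powr \<sigma> * g x) - c * (g x powr p * g1 x)
        + (\<sigma> * x powr (\<sigma> - 1) * ((g x)\<^sup>2 / 2) + g x * g1 x * x powr \<sigma>)) (at x)"
      unfolding e_def
      by (intro DERIV_add DERIV_diff DERIV_cmult DERIV_mult deriv_half_square d1 d2 dg dg1 x)
    then show ?thesis by (simp add: algebra_simps)
  qed
  have ce: "continuous_on {a..b} e"
    unfolding e_def using \<sigma> p ab nonneg
    by (intro continuous_intros cont continuous_on_powr') auto
  have mono: "e x \<le> e y" if "a \<le> x" "x \<le> y" "y \<le> b" for x y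
  proof (rule DERIV_nonneg_imp_increasing_open[OF that(2)])
    fix z assume z: "x < z" "z < y"
    show "\<exists>d. (e has_real_derivative d) (at z) \<and> 0 \<le> d"
      using de[of z] z that \<sigma> by (intro exI[of _ "\<sigma> * z powr (\<sigma> - 1) * ((g z)\<^sup>2 / 2)"]) auto
  qed (use that in \<open>auto intro: continuous_on_subset[OF ce]\<close>)
  have "0 \<le> e a" using zeros p by (simp add: e_def)
  moreover have "e b = 0" using zeros p by (simp add: e_def)
  ultimately have zero: "e x = 0" if "a \<le> x" "x \<le> b" for x
    using mono[of a x] mono[of x b] that by simp
  have "((\<lambda>_. 0) has_real_derivative \<sigma> * \<xi> powr (\<sigma> - 1) * ((g \<xi>)\<^sup>2 / 2)) (at \<xi>)"
  proof (rule has_field_derivative_transform_within_open[OF de[OF \<xi>], of "{a<..<b}"])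
    show "e x = 0" if "x \<in> {a<..<b}" for x using zero[of x] that by simp
  qed (use \<xi> in auto)
  then have "\<sigma> * \<xi> powr (\<sigma> - 1) * ((g \<xi>)\<^sup>2 / 2) = 0" by (rule DERIV_unique) (rule DERIV_const)
  then show ?thesis using \<sigma> \<xi> ab by simp
qed

lemma deriv_reverse:
  fixes u :: "real \<Rightarrow> real"
  assumes \<eta>: "0 < \<eta>"
    and du: "\<And>t. t \<in> {0..1} \<Longrightarrow> (u has_real_derivative \<eta> * D t) (at t within {0..1})"
    and \<xi>: "\<xi> \<in> {0..\<eta>}"
  shows "((\<lambda>\<xi>. u (1 - \<xi> / \<eta>)) has_real_derivative - D (1 - \<xi> / \<eta>)) (at \<xi> within {0..\<eta>})"
proof -
  have sub: "(\<lambda>\<xi>. 1 - \<xi> / \<eta>) ` {0..\<eta>} \<subseteq> {0..1}" using \<eta> by (auto simp: field_simps)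
  have "(u has_real_derivative \<eta> * D (1 - \<xi> / \<eta>)) (at (1 - \<xi> / \<eta>) within (\<lambda>\<xi>. 1 - \<xi> / \<eta>) ` {0..\<eta>})"
    using \<eta> \<xi> by (intro DERIV_subset[OF du sub]) auto
  moreover have "((\<lambda>\<xi>. 1 - \<xi> / \<eta>) has_real_derivative - (1 / \<eta>)) (at \<xi> within {0..\<eta>})"
    using DERIV_diff[OF DERIV_const DERIV_cdivide[OF DERIV_ident], of 1 \<eta>] by simp
  ultimately have "(u \<circ> (\<lambda>\<xi>. 1 - \<xi> / \<eta>) has_real_derivative \<eta> * D (1 - \<xi> / \<eta>) * - (1 / \<eta>)) (at \<xi> within {0..\<eta>})"
    by (rule DERIV_image_chain)
  then show ?thesis using \<eta> by (simp add: o_def)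
qed

text \<open>In normalised backward time 0 is the interface and 1 the origin; \<open>v 1 = 0\<close>
  is the flatness that (P1) demands there.\<close>

definition interface_orbit :: "real \<Rightarrow> real \<Rightarrow> real \<Rightarrow> (real \<Rightarrow> real) \<Rightarrow> (real \<Rightarrow> real) \<Rightarrow> bool" where
  "interface_orbit p \<sigma> \<eta> h v \<longleftrightarrow> 0 < \<eta> \<and>
    (\<forall>t\<in>{0..1}. (h has_real_derivative \<eta> * v t) (at t within {0..1})) \<and>
    (\<forall>t\<in>{0..1}. (v has_real_derivative \<eta> * (h t powr p - (\<eta> * (1 - t)) powr \<sigma> * h t)) (at t within {0..1})) \<and>
    h 0 = 0 \<and> v 0 = 0 \<and> v 1 = 0 \<and> (\<forall>t\<in>{0<..1}. 0 < h t)"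

text \<open>Positivity right after the start is enough: a later zero of \<open>h\<close> would be a
  zero of the solution at \<xi> = \<open>\<eta> * (1 - t)\<close>, and rigidity would make the
  solution vanish from there to the interface.\<close>

lemma interface_orbitI:
  assumes p: "0 < p" and \<sigma>: "0 < \<sigma>" and \<eta>: "0 < \<eta>"
    and dh: "\<And>t. t \<in> {0..1} \<Longrightarrow> (h has_real_derivative \<eta> * v t) (at t within {0..1})"
    and dv: "\<And>t. t \<in> {0..1} \<Longrightarrow> (v has_real_derivative \<eta> * (h t powr p - (\<eta> * (1 - t)) powr \<sigma> * h t)) (at t within {0..1})"
    and nonneg: "\<And>t. t \<in> {0..1} \<Longrightarrow> 0 \<le> h t" and ends: "h 0 = 0" "v 0 = 0" "v 1 = 0"
    and start: "0 < t1" "\<And>t. 0 < t \<Longrightarrow> t < t1 \<Longrightarrow> t \<le> 1 \<Longrightarrow> 0 < h t"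
  shows "interface_orbit p \<sigma> \<eta> h v"
proof -
  have "0 < h t" if t: "0 < t" "t \<le> 1" for t
  proof (rule ccontr)
    assume "\<not> 0 < h t"
    then have ht: "h t = 0" using nonneg[of t] t by simp
    define g where "g \<xi> = h (1 - \<xi> / \<eta>)" for \<xi>
    define g1 where "g1 \<xi> = - v (1 - \<xi> / \<eta>)" for \<xi>
    define a where "a = \<eta> * (1 - t)"
    have a: "0 \<le> a" "a < \<eta>" using t \<eta> by (auto simp: a_def)
    have dg: "(g has_real_derivative g1 \<xi>) (at \<xi> within {0..\<eta>})" if "\<xi> \<in> {0..\<eta>}" for \<xi>
      unfolding g_def g1_def by (rule deriv_reverse[OF \<eta> dh that])
    have dg1: "(g1 has_real_derivative 1 * g \<xi> powr p - \<xi> powr \<sigma> * g \<xi>) (at \<xi> within {0..\<eta>})" if "\<xi> \<in> {0..\<eta>}" for \<xi>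
      unfolding g_def g1_def using DERIV_minus[OF deriv_reverse[OF \<eta> dv that]] \<eta> by simp
    have cg: "continuous_on {0..\<eta>} g" "continuous_on {0..\<eta>} g1"
      using dg dg1 DERIV_continuous continuous_on_eq_continuous_within by blast+
    have "g \<xi> = 0" if "a < \<xi>" "\<xi> < \<eta>" for \<xi>
    proof (rule solution_vanishes_between_zeros[of p 1 \<sigma> a \<eta> g g1])
      show "(g has_real_derivative g1 x) (at x)" "(g1 has_real_derivative 1 * g x powr p - x powr \<sigma> * g x) (at x)"
        if "a < x" "x < \<eta>" for x
        using dg[of x] dg1[of x] that a by (auto simp: at_within_Icc_at)
      show "continuous_on {a..\<eta>} g" "continuous_on {a..\<eta>} g1" using a by (auto intro: continuous_on_subset[OF cg(1)] continuous_on_subset[OF cg(2)])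
      show "0 \<le> g x" if "a \<le> x" "x \<le> \<eta>" for x using that a \<eta> by (auto simp: g_def intro!: nonneg)
      show "g a = 0" using ht \<eta> by (simp add: g_def a_def)
      show "g \<eta> = 0" "g1 \<eta> = 0" using ends \<eta> by (auto simp: g_def g1_def)
    qed (use p \<sigma> a that in auto)
    note zero = this
    define s where "s = min t t1 / 2"
    have s: "0 < s" "s < t" "s < t1" using t start(1) by (auto simp: s_def min_def)
    have "g (\<eta> * (1 - s)) = 0" by (rule zero) (use s \<eta> in \<open>auto simp: a_def\<close>)
    then have "h s = 0" using \<eta> by (simp add: g_def)
    then show False using start(2)[of s] s t by simp
  qed
  then show ?thesis using assms by (auto simp: interface_orbit_def)
qed

section \<open>Choice of the constants and existence of the limit orbits\<close>

lemma ex_small_amplitude: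
  fixes p A :: real
  assumes p: "0 < p" "p < 1" and A: "0 < A"
  obtains \<epsilon>0 where "0 < \<epsilon>0"
    "\<And>\<epsilon>. 0 < \<epsilon> \<Longrightarrow> \<epsilon> < \<epsilon>0 \<Longrightarrow> 2 * \<epsilon>\<^sup>2 \<le> \<epsilon> powr (p + 1) / (p + 1) \<and> \<epsilon> powr (p + 1) / (p + 1) \<le> A"
proof -
  have t: "((\<lambda>\<epsilon>::real. \<epsilon> powr q) \<longlongrightarrow> 0) (at_right 0)" if "0 < q" for q :: real
  proof -
    have "((\<lambda>\<epsilon>::real. \<epsilon> powr q) \<longlongrightarrow> 0 powr q) (at_right 0)"
      using that by (intro tendsto_powr' tendsto_ident_at tendsto_const) (auto simp: eventually_at_filter)
    then show ?thesis using that by simp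
  qed
  have "\<forall>\<^sub>F \<epsilon>::real in at_right 0. \<epsilon> powr (1 - p) < 1 / (2 * (p + 1))"
    using order_tendstoD(2)[OF t[of "1 - p"], of "1 / (2 * (p + 1))"] p by simp
  moreover have "\<forall>\<^sub>F \<epsilon>::real in at_right 0. \<epsilon> powr (p + 1) < A * (p + 1)"
    using order_tendstoD(2)[OF t[of "p + 1"], of "A * (p + 1)"] p A by simp
  ultimately have "\<forall>\<^sub>F \<epsilon>::real in at_right 0. \<epsilon> powr (1 - p) < 1 / (2 * (p + 1)) \<and> \<epsilon> powr (p + 1) < A * (p + 1)"
    by (rule eventually_conj)
  then obtain \<epsilon>0 :: real where \<epsilon>0: "0 < \<epsilon>0"
    "\<And>\<epsilon>. 0 < \<epsilon> \<Longrightarrow> \<epsilon> < \<epsilon>0 \<Longrightarrow> \<epsilon> powr (1 - p) < 1 / (2 * (p + 1)) \<and> \<epsilon> powr (p + 1) < A * (p + 1)"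
    unfolding eventually_at_right_field by auto
  show ?thesis
  proof (rule that[OF \<epsilon>0(1)], intro conjI)
    fix \<epsilon> :: real assume \<epsilon>: "0 < \<epsilon>" "\<epsilon> < \<epsilon>0"
    have "\<epsilon>\<^sup>2 = \<epsilon> powr (1 - p) * \<epsilon> powr (p + 1)" using \<epsilon> by (simp flip: powr_add)
    also have "\<dots> \<le> 1 / (2 * (p + 1)) * \<epsilon> powr (p + 1)"
      using \<epsilon>0(2)[OF \<epsilon>] by (intro mult_right_mono) auto
    also have "\<dots> = \<epsilon> powr (p + 1) / (p + 1) / 2" by (simp add: field_simps)
    finally have "\<epsilon>\<^sup>2 \<le> \<epsilon> powr (p + 1) / (p + 1) / 2" .
    moreover have "2 * a \<le> b" if "a \<le> b / 2" for a b :: real using that by simp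
    ultimately show "2 * \<epsilon>\<^sup>2 \<le> \<epsilon> powr (p + 1) / (p + 1)" by blast
    show "\<epsilon> powr (p + 1) / (p + 1) \<le> A" using \<epsilon>0(2)[OF \<epsilon>] p by (simp add: pos_divide_le_eq)
  qed
qed

lemma ex_interface_orbits:
  fixes p :: real and k :: nat
  assumes p: "0 < p" "p < 1"
  obtains \<delta> where "0 < \<delta>"
    "\<And>\<sigma> j. 0 < \<sigma> \<Longrightarrow> \<sigma> < \<delta> \<Longrightarrow> 1 \<le> j \<Longrightarrow> j \<le> k \<Longrightarrow> \<exists>\<eta> h v. interface_orbit p \<sigma> \<eta> h v \<and>
       integral {0..1} (\<lambda>t. angular_rate p \<sigma> \<eta> t (h t) (v t)) = - real j * pi"
proof -
  have gap: "0 < energy_gap p" using p by (simp add: energy_gap_def)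
  obtain C where C: "energy_gap p \<le> C" "\<And>x. x \<ge> 0 \<Longrightarrow> x powr (p + 1) / (p + 1) \<le> x\<^sup>2 / 4 + C"
    using ex_subquadratic_bound[OF p] by metis
  have C0: "0 < C" using C(1) gap by simp
  define L where "L = rotation_deficit p C"
  have L: "0 < L" using low_height_range[OF p] p C0 by (simp add: L_def rotation_deficit_def)
  define X where "X = 1 + 2 * sqrt (8 * C) powr (1 - p)"
  \<comment> \<open>Chosen so that the main term of \<open>angle_le\<close> at \<eta> =
    \<open>R\<close> is at most \<open>- (k * pi) - 1\<close>; the spare 1 absorbs the drift
    term.\<close>
  define R where "R = max 1 (2 * (X + L * (k * pi + 1)) / escape_rate p)"
  have R: "1 \<le> R" by (simp add: R_def)
  have angle_R: "(X - R * escape_rate p / 2) / L \<le> - (k * pi) - 1"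
  proof -
    have "2 * (X + L * (k * pi + 1)) / escape_rate p \<le> R" by (simp add: R_def)
    then have "2 * (X + L * (k * pi + 1)) \<le> R * escape_rate p"
      using escape_rate_range[OF p] by (simp add: pos_divide_le_eq)
    then have "X - R * escape_rate p / 2 \<le> (- (k * pi) - 1) * L" by (simp add: algebra_simps)
    then show ?thesis unfolding pos_divide_le_eq[OF L] .
  qed
  define K where "K = drift_effect p C"
  have K: "0 \<le> K" using gap C0 by (simp add: K_def drift_effect_def)
  \<comment> \<open>The first two entries provide the \<open>drift\<close> conditions of
    \<open>backward_orbit\<close>; the third bounds the drift term of the angle by 1.\<close>
  define b where "b = min (energy_gap p / (8 * C)) (min (ln 2 / 2) (1 / (K + 1)))"
  have b: "0 < b" using gap C0 K by (simp add: b_def)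
  have "\<forall>\<^sub>F \<sigma> in at_right 0. drift R \<sigma> R < b"
    using order_tendstoD(2)[OF tendsto_drift_0[OF R] b] .
  moreover have "\<forall>\<^sub>F \<sigma> in at_right 0. R powr \<sigma> < 2"
  proof -
    have "((\<lambda>\<sigma>. R powr \<sigma>) \<longlongrightarrow> R powr 0) (at_right 0)" by (intro tendsto_intros) (use R in auto)
    then show ?thesis using order_tendstoD(2)[of "\<lambda>\<sigma>. R powr \<sigma>" "R powr 0" "at_right 0" 2] R by simp
  qed
  ultimately have "\<forall>\<^sub>F \<sigma> in at_right 0. drift R \<sigma> R < b \<and> R powr \<sigma> < 2" by (rule eventually_conj)
  then obtain \<delta> where \<delta>: "0 < \<delta>" "\<And>\<sigma>. 0 < \<sigma> \<Longrightarrow> \<sigma> < \<delta> \<Longrightarrow> drift R \<sigma> R < b \<and> R powr \<sigma> < 2"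
    unfolding eventually_at_right_field by auto
  obtain \<epsilon>0 where \<epsilon>0: "0 < \<epsilon>0" "\<And>\<epsilon>. 0 < \<epsilon> \<Longrightarrow> \<epsilon> < \<epsilon>0 \<Longrightarrow>
      2 * \<epsilon>\<^sup>2 \<le> \<epsilon> powr (p + 1) / (p + 1) \<and> \<epsilon> powr (p + 1) / (p + 1) \<le> energy_gap p / 4"
    using ex_small_amplitude[OF p, of "energy_gap p / 4"] gap by auto
  \<comment> \<open>The denominators begin at 2, which keeps each term strictly below
    \<open>\<epsilon>0\<close>.\<close>
  define \<epsilon> where "\<epsilon> n = \<epsilon>0 * inverse (real (Suc (Suc n)))" for n
  have \<epsilon>: "0 < \<epsilon> n" "\<epsilon> n < \<epsilon>0" for n using \<epsilon>0(1) by (auto simp: \<epsilon>_def field_simps intro!: add_pos_nonneg)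
  have lim_\<epsilon>: "\<epsilon> \<longlonglongrightarrow> 0"
    using tendsto_mult[OF tendsto_const LIMSEQ_Suc[OF LIMSEQ_inverse_real_of_nat], of \<epsilon>0]
    unfolding \<epsilon>_def by simp
  show ?thesis
  proof (rule that[OF \<delta>(1)])
    fix \<sigma> :: real and j :: nat assume \<sigma>: "0 < \<sigma>" "\<sigma> < \<delta>" and j: "1 \<le> j" "j \<le> k"
    have d: "drift R \<sigma> R < b" and R2: "R powr \<sigma> \<le> 2" using \<delta>(2)[OF \<sigma>] by auto
    have d1: "8 * C * drift R \<sigma> R \<le> energy_gap p"
    proof -
      have "drift R \<sigma> R \<le> energy_gap p / (8 * C)" using d by (simp add: b_def)
      then show ?thesis using C0 by (simp add: pos_le_divide_eq mult.commute)
    qed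
    have d2: "2 * drift R \<sigma> R \<le> ln 2" using d by (simp add: b_def)
    have d3: "K * drift R \<sigma> R \<le> 1"
    proof -
      have "drift R \<sigma> R \<le> 1 / (K + 1)" using d by (simp add: b_def)
      then have "drift R \<sigma> R * (K + 1) \<le> 1" using K by (simp add: pos_le_divide_eq)
      moreover have "0 \<le> drift R \<sigma> R" using R \<sigma> by (intro drift_nonneg) auto
      ultimately show ?thesis by (simp add: algebra_simps)
    qed
    have "- (real k * pi) \<le> - real j * pi" using j by simp
    then have J: "(X - R * escape_rate p / 2) / L + K * drift R \<sigma> R \<le> - real j * pi"
      using angle_R d3 by linarith
    have "\<exists>\<eta> h v. backward_orbit p \<sigma> R C \<eta> h v \<and> h 0 = \<epsilon> n \<and>
        integral {0..1} (\<lambda>t. angular_rate p \<sigma> \<eta> t (h t) (v t)) = - real j * pi" for n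
    proof -
      have "- real j * pi \<le> 0" by simp
      from ex_orbit_with_angle[OF p \<sigma>(1) R R2 C d1 d2 \<epsilon>(1) _ _ this J[unfolded X_def L_def K_def], of n]
      show ?thesis using \<epsilon>0(2)[OF \<epsilon>[of n]] by metis
    qed
    then obtain \<eta> h v where orbit: "\<And>n. backward_orbit p \<sigma> R C (\<eta> n) (h n) (v n)" "\<And>n. h n 0 = \<epsilon> n"
      "\<And>n. integral {0..1} (\<lambda>t. angular_rate p \<sigma> (\<eta> n) t (h n t) (v n t)) = - real j * pi"
      by metis
    obtain \<eta>' h' v' where lim: "\<eta>' \<in> {0..R}"
      "\<And>t. t \<in> {0..1} \<Longrightarrow> (h' has_real_derivative \<eta>' * v' t) (at t within {0..1})"
      "\<And>t. t \<in> {0..1} \<Longrightarrow> (v' has_real_derivative \<eta>' * (h' t powr p - (\<eta>' * (1 - t)) powr \<sigma> * h' t)) (at t within {0..1})"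
      "\<And>t. t \<in> {0..1} \<Longrightarrow> 0 \<le> h' t" "h' 0 = 0" "v' 0 = 0" "v' 1 = 0"
      "integral {0..1} (\<lambda>t. angular_rate p \<sigma> \<eta>' t (h' t) (v' t)) = - real j * pi"
      "\<And>t. t \<in> {0..1} \<Longrightarrow> \<eta>' * t * sqrt (8 * C) < low_height p / 2 \<Longrightarrow>
        (1 - p) * escape_rate p * (\<eta>' * t)\<^sup>2 / 4 \<le> h' t powr (1 - p)"
      by (rule limit_orbit[OF orbit(1,2) lim_\<epsilon> orbit(3)]) (rule that; assumption)
    \<comment> \<open>With \<eta>' = 0 no angle would be swept, whereas it is
      \<open>- j * pi\<close> with \<open>j \<ge> 1\<close>.\<close>
    have \<eta>': "0 < \<eta>'"
    proof (rule ccontr)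
      assume "\<not> 0 < \<eta>'"
      then have "\<eta>' = 0" using lim(1) by simp
      then have "- real j * pi = 0" using lim(8) by (simp add: angular_rate_def)
      then show False using j by simp
    qed
    \<comment> \<open>Before this time the growth bound holds for the limit, which gives the
      positive start needed by \<open>interface_orbitI\<close>.\<close>
    define t1 where "t1 = low_height p / 2 / (\<eta>' * sqrt (8 * C))"
    have "interface_orbit p \<sigma> \<eta>' h' v'"
    proof (rule interface_orbitI[OF p(1) \<sigma>(1) \<eta>' lim(2-7)])
      show "0 < t1" using low_height_range[OF p] \<eta>' C0 by (simp add: t1_def)
      fix t assume t: "0 < t" "t < t1" "t \<le> 1"
      have "t * (\<eta>' * sqrt (8 * C)) < low_height p / 2"
        using t(2) \<eta>' C0 unfolding t1_def by (subst (asm) pos_less_divide_eq) auto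
      then have "\<eta>' * t * sqrt (8 * C) < low_height p / 2" by (simp add: mult_ac)
      then have "(1 - p) * escape_rate p * (\<eta>' * t)\<^sup>2 / 4 \<le> h' t powr (1 - p)"
        using lim(9)[of t] t by simp
      moreover have "0 < (1 - p) * escape_rate p * (\<eta>' * t)\<^sup>2 / 4"
        using p escape_rate_range[OF p] \<eta>' t by simp
      ultimately have "0 < h' t powr (1 - p)" by linarith
      then show "0 < h' t" using lim(4)[of t] t by (simp add: less_le)
    qed
    then show "\<exists>\<eta> h v. interface_orbit p \<sigma> \<eta> h v \<and>
       integral {0..1} (\<lambda>t. angular_rate p \<sigma> \<eta> t (h t) (v t)) = - real j * pi"
      using lim(8) by blast
  qed
qed

section \<open>Profiles\<close>

text \<open>Gluing is an issue only at \<eta>, where both one-sided derivatives are 0 and the filter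
  is the supremum of the one-sided ones. The lemma is applied to the m-th power of the profile and
  again to its derivative.\<close>

lemma deriv_extend_zero:
  fixes u du :: "real \<Rightarrow> real"
  assumes \<eta>: "0 < \<eta>"
    and du: "\<And>\<xi>. \<xi> \<in> {0..\<eta>} \<Longrightarrow> (u has_real_derivative du \<xi>) (at \<xi> within {0..\<eta>})"
    and zero: "u \<eta> = 0" "du \<eta> = 0" and \<xi>: "0 \<le> \<xi>"
  shows "((\<lambda>\<xi>. if \<xi> \<le> \<eta> then u \<xi> else 0) has_real_derivative (if \<xi> \<le> \<eta> then du \<xi> else 0)) (at \<xi> within {0..})"
proof -
  let ?w = "\<lambda>\<xi>. if \<xi> \<le> \<eta> then u \<xi> else 0"
  have left: "(?w has_real_derivative du \<xi>) (at \<xi> within {0..\<eta>})" if "\<xi> \<le> \<eta>"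
    by (rule has_field_derivative_transform_within[OF du zero_less_one]) (use that \<xi> in auto)
  have right: "(?w has_real_derivative 0) (at \<xi> within {\<eta>..})" if "\<eta> \<le> \<xi>"
    by (rule has_field_derivative_transform_within[OF DERIV_const[of 0] zero_less_one]) (use that zero in auto)
  consider "\<xi> < \<eta>" | "\<xi> = \<eta>" | "\<eta> < \<xi>" by linarith
  then show ?thesis
  proof cases
    case 1
    have "at \<xi> within {0..} = at \<xi> within {0..\<eta>}"
      by (rule at_within_nhd[of \<xi> "{..<\<eta>}"]) (use 1 in auto)
    then show ?thesis using left 1 by simp
  next
    case 2
    have at: "at \<xi> within {0..} = sup (at \<xi> within {0..\<eta>}) (at \<xi> within {\<eta>..})"
    proof -
      have "{0..} = {0..\<eta>} \<union> {\<eta>..}" using \<eta> by auto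
      then show ?thesis by (simp only: at_within_union)
    qed
    show ?thesis using left right 2 zero
      unfolding has_field_derivative_iff unfolding at by (simp add: filterlim_sup)
  next
    case 3
    have "at \<xi> within {0..} = at \<xi> within {\<eta>..}"
      by (rule at_within_nhd[of \<xi> "{\<eta><..}"]) (use 3 \<eta> in auto)
    then show ?thesis using right 3 by simp
  qed
qed

lemma continuous_on_extend_zero:
  fixes u :: "real \<Rightarrow> real"
  assumes \<eta>: "0 < \<eta>" and u: "continuous_on {0..\<eta>} u" "u \<eta> = 0"
  shows "continuous_on {0..} (\<lambda>\<xi>. if \<xi> \<le> \<eta> then u \<xi> else 0)"
proof -
  have "continuous_on ({0..\<eta>} \<union> {\<eta>..}) (\<lambda>\<xi>. if \<xi> \<le> \<eta> then u \<xi> else 0)"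
    by (rule continuous_on_If) (use u in auto)
  moreover have "{0..\<eta>} \<union> {\<eta>..} = {0..}" using \<eta> by auto
  ultimately show ?thesis by simp
qed

text \<open>The solution of \<open>A = A powr (1 / m) / (m - 1)\<close>: writing the m-th power of
  the profile as A x removes the coefficient 1 / (m - 1) from the equation for x.\<close>

definition amplitude :: "real \<Rightarrow> real" where
  "amplitude m = (1 / (m - 1)) powr (m / (m - 1))"

definition profile :: "real \<Rightarrow> real \<Rightarrow> (real \<Rightarrow> real) \<Rightarrow> real \<Rightarrow> real" where
  "profile m \<eta> h \<xi> = (if \<xi> \<le> \<eta> then (amplitude m * h (1 - \<xi> / \<eta>)) powr (1 / m) else 0)"

lemma amplitude_pos: "1 < m \<Longrightarrow> 0 < amplitude m" by (simp add: amplitude_def)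

lemma amplitude_eq:
  assumes m: "1 < m"
  shows "1 / (m - 1) * amplitude m powr (1 / m) = amplitude m"
proof -
  have "1 / (m - 1) * amplitude m powr (1 / m) = (1 / (m - 1)) powr 1 * (1 / (m - 1)) powr (1 / (m - 1))"
    using m by (simp add: amplitude_def powr_powr)
  also have "\<dots> = (1 / (m - 1)) powr (1 + 1 / (m - 1))" by (rule powr_add[symmetric])
  also have "1 + 1 / (m - 1) = m / (m - 1)" using m by (simp add: field_simps)
  finally show ?thesis by (simp add: amplitude_def)
qed

context
  fixes m \<sigma> \<eta> :: real and h v :: "real \<Rightarrow> real"
  assumes m: "1 < m" and \<sigma>: "0 < \<sigma>" and orbit: "interface_orbit (1 / m) \<sigma> \<eta> h v"
begin

lemma interface_point_pos: "0 < \<eta>"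
  and interface_deriv_h: "t \<in> {0..1} \<Longrightarrow> (h has_real_derivative \<eta> * v t) (at t within {0..1})"
  and interface_deriv_v: "t \<in> {0..1} \<Longrightarrow> (v has_real_derivative \<eta> * (h t powr (1 / m) - (\<eta> * (1 - t)) powr \<sigma> * h t)) (at t within {0..1})"
  and interface_ends: "h 0 = 0" "v 0 = 0" "v 1 = 0"
  and interface_h_pos: "0 < t \<Longrightarrow> t \<le> 1 \<Longrightarrow> 0 < h t"
  using orbit by (auto simp: interface_orbit_def)

lemma interface_h_nonneg: "0 \<le> t \<Longrightarrow> t \<le> 1 \<Longrightarrow> 0 \<le> h t"
  using interface_h_pos[of t] interface_ends by (cases "t = 0") auto

lemma rescaled_range: "0 \<le> \<xi> \<Longrightarrow> \<xi> \<le> \<eta> \<Longrightarrow> 0 \<le> 1 - \<xi> / \<eta> \<and> 1 - \<xi> / \<eta> \<le> 1"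
  using interface_point_pos by auto

lemma profile_powr: "0 \<le> \<xi> \<Longrightarrow>
    profile m \<eta> h \<xi> powr m = (if \<xi> \<le> \<eta> then amplitude m * h (1 - \<xi> / \<eta>) else 0)"
  using m amplitude_pos[OF m] interface_h_nonneg rescaled_range[of \<xi>] by (simp add: profile_def powr_powr)

lemma profile_pos: "0 \<le> \<xi> \<Longrightarrow> \<xi> < \<eta> \<Longrightarrow> 0 < profile m \<eta> h \<xi>"
  using amplitude_pos[OF m] interface_h_pos[of "1 - \<xi> / \<eta>"] interface_point_pos by (simp add: profile_def)

lemma profile_zero: "\<eta> \<le> \<xi> \<Longrightarrow> profile m \<eta> h \<xi> = 0"
  using interface_ends interface_point_pos by (simp add: profile_def)

lemma profile_nonneg: "0 \<le> profile m \<eta> h \<xi>" by (simp add: profile_def)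

text \<open>Derivative of the m-th power of the profile; the sign comes from the reversal of
  time.\<close>

definition "flux \<xi> = (if \<xi> \<le> \<eta> then - (amplitude m * v (1 - \<xi> / \<eta>)) else 0)"

definition "flux_deriv \<xi> =
  (if \<xi> \<le> \<eta> then amplitude m * (h (1 - \<xi> / \<eta>) powr (1 / m) - \<xi> powr \<sigma> * h (1 - \<xi> / \<eta>)) else 0)"

lemma deriv_profile_powr:
  assumes \<xi>: "0 \<le> \<xi>"
  shows "((\<lambda>\<xi>. profile m \<eta> h \<xi> powr m) has_real_derivative flux \<xi>) (at \<xi> within {0..})"
proof -
  have "((\<lambda>\<xi>. amplitude m * h (1 - \<xi> / \<eta>)) has_real_derivative - (amplitude m * v (1 - \<xi> / \<eta>))) (at \<xi> within {0..\<eta>})"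
    if "\<xi> \<in> {0..\<eta>}" for \<xi>
    using DERIV_cmult[OF deriv_reverse[OF interface_point_pos interface_deriv_h that], of "amplitude m"] by simp
  from deriv_extend_zero[OF interface_point_pos this _ _ \<xi>]
  have "((\<lambda>\<xi>. if \<xi> \<le> \<eta> then amplitude m * h (1 - \<xi> / \<eta>) else 0) has_real_derivative flux \<xi>) (at \<xi> within {0..})"
    using interface_ends interface_point_pos by (simp add: flux_def)
  then show ?thesis
    by (rule has_field_derivative_transform_within[OF _ zero_less_one]) (use \<xi> profile_powr in auto)
qed

lemma deriv_flux:
  assumes \<xi>: "0 \<le> \<xi>"
  shows "(flux has_real_derivative flux_deriv \<xi>) (at \<xi> within {0..})"
proof -
  have "((\<lambda>\<xi>. - (amplitude m * v (1 - \<xi> / \<eta>))) has_real_derivative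
     amplitude m * (h (1 - \<xi> / \<eta>) powr (1 / m) - \<xi> powr \<sigma> * h (1 - \<xi> / \<eta>))) (at \<xi> within {0..\<eta>})"
    if "\<xi> \<in> {0..\<eta>}" for \<xi>
  proof -
    have "\<eta> * (1 - (1 - \<xi> / \<eta>)) = \<xi>" using interface_point_pos by simp
    then show ?thesis
      using DERIV_minus[OF DERIV_cmult[OF deriv_reverse[OF interface_point_pos interface_deriv_v that], of "amplitude m"]]
      by (simp only: mult_minus_right minus_minus)
  qed
  from deriv_extend_zero[OF interface_point_pos this _ _ \<xi>]
  show ?thesis using interface_ends interface_point_pos unfolding flux_def flux_deriv_def by simp
qed

lemma cont_h_reverse: "continuous_on {0..\<eta>} (\<lambda>\<xi>. h (1 - \<xi> / \<eta>))"
  using deriv_reverse[OF interface_point_pos interface_deriv_h] DERIV_continuous continuous_on_eq_continuous_within by blast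

lemma cont_flux_deriv: "continuous_on {0..} flux_deriv"
  unfolding flux_deriv_def
  by (intro continuous_on_extend_zero interface_point_pos continuous_intros cont_h_reverse continuous_on_powr')
     (use m \<sigma> interface_h_nonneg rescaled_range interface_ends interface_point_pos in auto)

lemma cont_profile: "continuous_on {0..} (profile m \<eta> h)"
  unfolding profile_def
  by (intro continuous_on_extend_zero interface_point_pos continuous_intros cont_h_reverse continuous_on_powr')
     (use m amplitude_pos[OF m] interface_h_nonneg rescaled_range interface_ends interface_point_pos in auto)

lemma profile_equation:
  assumes \<xi>: "0 \<le> \<xi>"
  shows "flux_deriv \<xi> - 1 / (m - 1) * profile m \<eta> h \<xi> + \<xi> powr \<sigma> * profile m \<eta> h \<xi> powr m = 0"
proof (cases "\<xi> \<le> \<eta>")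
  case True
  define x where "x = h (1 - \<xi> / \<eta>)"
  have "0 \<le> x" unfolding x_def using interface_h_nonneg rescaled_range[OF \<xi> True] by blast
  then have "1 / (m - 1) * profile m \<eta> h \<xi> = 1 / (m - 1) * amplitude m powr (1 / m) * x powr (1 / m)"
    using True amplitude_pos[OF m] by (simp add: profile_def x_def powr_mult)
  then have "1 / (m - 1) * profile m \<eta> h \<xi> = amplitude m * x powr (1 / m)"
    unfolding amplitude_eq[OF m] .
  moreover have "profile m \<eta> h \<xi> powr m = amplitude m * x" using profile_powr[OF \<xi>] True by (simp add: x_def)
  moreover have "flux_deriv \<xi> = amplitude m * (x powr (1 / m) - \<xi> powr \<sigma> * x)" using True by (simp add: flux_deriv_def x_def)
  ultimately show ?thesis by (simp add: algebra_simps)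
next
  case False
  then show ?thesis by (simp add: flux_deriv_def profile_zero)
qed

text \<open>At 0 the m-th power of the profile is positive and has derivative 0, because
  \<open>v 1 = 0\<close>. Positivity makes the root differentiable there, so the chain rule
  applies.\<close>

lemma profile_P1: "P1 (profile m \<eta> h)"
  unfolding P1_def
proof
  show p0: "0 < profile m \<eta> h 0" using profile_pos[of 0] interface_point_pos by simp
  have "flux 0 = 0" using interface_ends interface_point_pos by (simp add: flux_def)
  then have d: "((\<lambda>\<xi>. profile m \<eta> h \<xi> powr m) has_real_derivative 0) (at 0 within {0..})"
    using deriv_profile_powr[of 0] by simp
  have "0 < profile m \<eta> h 0 powr m" using p0 by simp
  from DERIV_chain2[OF has_real_derivative_powr[OF this, of "1 / m"] d]
  have "((\<lambda>\<xi>. (profile m \<eta> h \<xi> powr m) powr (1 / m)) has_real_derivative 0) (at 0 within {0..})" by simp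
  then show "(profile m \<eta> h has_real_derivative 0) (at 0 within {0..})"
    using m profile_nonneg by (simp add: powr_powr)
qed

lemma profile_good: "good_profile_with_interface_at m \<sigma> \<eta> (profile m \<eta> h)"
  unfolding good_profile_with_interface_at_def good_profile_def
proof (intro conjI)
  show "solution_on m \<sigma> {0..} (profile m \<eta> h)"
    unfolding solution_on_def C2_on_def
    by (intro conjI, rule cont_profile, simp add: profile_nonneg, rule exI[of _ flux], rule exI[of _ flux_deriv])
       (simp add: deriv_profile_powr deriv_flux cont_flux_deriv profile_equation del: times_divide_eq_left)
  show "P1 (profile m \<eta> h) \<or> P2 m (profile m \<eta> h)" using profile_P1 by simp
  have "flux \<eta> = 0" using interface_ends interface_point_pos by (simp add: flux_def)
  moreover have "at \<eta> within {0..} = at \<eta>" using interface_point_pos by (intro at_within_interior) auto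
  ultimately show "((\<lambda>\<xi>. profile m \<eta> h \<xi> powr m) has_real_derivative 0) (at \<eta>)"
    using deriv_profile_powr[of \<eta>] interface_point_pos by simp
  show "\<exists>\<delta>>0. \<delta> \<le> \<eta> \<and> (\<forall>\<xi>\<in>{\<eta> - \<delta><..<\<eta>}. 0 < profile m \<eta> h \<xi>)"
    using interface_point_pos profile_pos by (intro exI[of _ \<eta>]) auto
qed (use interface_point_pos profile_zero in auto)

end

text \<open>A profile determines its orbit: \<eta> is the first zero, \<open>h\<close> a multiple of
  the m-th power, and \<open>v\<close> comes from the derivative of \<open>h\<close> inside and from
  the prescribed values at the ends. Equal profiles therefore sweep equal angles.\<close>

lemma profiles_different:
  assumes m: "1 < m" and \<sigma>: "0 < \<sigma>"
    and o1: "interface_orbit (1 / m) \<sigma> \<eta>1 h1 v1" and o2: "interface_orbit (1 / m) \<sigma> \<eta>2 h2 v2"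
    and angle: "integral {0..1} (\<lambda>t. angular_rate (1 / m) \<sigma> \<eta>1 t (h1 t) (v1 t))
      \<noteq> integral {0..1} (\<lambda>t. angular_rate (1 / m) \<sigma> \<eta>2 t (h2 t) (v2 t))"
  shows "different_profiles (profile m \<eta>1 h1) (profile m \<eta>2 h2)"
proof (rule ccontr)
  assume "\<not> ?thesis"
  then have same: "profile m \<eta>1 h1 \<xi> = profile m \<eta>2 h2 \<xi>" if "0 \<le> \<xi>" for \<xi>
    using that by (auto simp: different_profiles_def)
  have \<eta>: "0 < \<eta>1" "0 < \<eta>2" using o1 o2 by (auto simp: interface_orbit_def)
  have "\<eta>1 = \<eta>2"
    using profile_zero[OF m \<sigma> o1, of \<eta>1] profile_pos[OF m \<sigma> o2, of \<eta>1]
      profile_zero[OF m \<sigma> o2, of \<eta>2] profile_pos[OF m \<sigma> o1, of \<eta>2] same[of \<eta>1] same[of \<eta>2] \<eta>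
    by (metis less_irrefl less_linear less_imp_le order_refl)
  have h: "h1 t = h2 t" if t: "t \<in> {0..1}" for t
  proof -
    have "0 \<le> \<eta>1 * (1 - t)" "\<eta>1 * (1 - t) \<le> \<eta>1" using t \<eta> by auto
    then have "amplitude m * h1 t = amplitude m * h2 t"
      using same[of "\<eta>1 * (1 - t)"] profile_powr[OF m \<sigma> o1, of "\<eta>1 * (1 - t)"]
        profile_powr[OF m \<sigma> o2, of "\<eta>1 * (1 - t)"] \<open>\<eta>1 = \<eta>2\<close> \<eta> by simp
    then show ?thesis using amplitude_pos[OF m] by simp
  qed
  have v: "v1 t = v2 t" if t: "t \<in> {0..1}" for t
  proof -
    consider "t = 0" | "t = 1" | "0 < t" "t < 1" using t by fastforce
    then show ?thesis
    proof cases
      case 3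
      have d: "(h1 has_real_derivative \<eta>1 * v1 t) (at t)" "(h2 has_real_derivative \<eta>1 * v2 t) (at t)"
        using interface_deriv_h[OF m \<sigma> o1 t] interface_deriv_h[OF m \<sigma> o2 t] 3 \<open>\<eta>1 = \<eta>2\<close> by (auto simp: at_within_Icc_at)
      from d(1) have "(h2 has_real_derivative \<eta>1 * v1 t) (at t)"
        by (rule has_field_derivative_transform_within_open[where S = "{0<..<1}"]) (use h 3 in auto)
      then have "\<eta>1 * v1 t = \<eta>1 * v2 t" using d(2) by (rule DERIV_unique)
      then show ?thesis using \<eta> by simp
    qed (use interface_ends[OF m \<sigma> o1] interface_ends[OF m \<sigma> o2] in auto)
  qed
  have "integral {0..1} (\<lambda>t. angular_rate (1 / m) \<sigma> \<eta>1 t (h1 t) (v1 t))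
      = integral {0..1} (\<lambda>t. angular_rate (1 / m) \<sigma> \<eta>2 t (h2 t) (v2 t))"
    by (rule integral_cong) (simp add: h v \<open>\<eta>1 = \<eta>2\<close>)
  then show False using angle by contradiction
qed

text \<open>Under (P2) the m-th power of f has a zero at 0 and a double zero at the interface, so
  rigidity makes it vanish in between, against positivity just before the interface. Further zeros
  inside do no harm.\<close>

lemma interface_not_P2:
  assumes m: "1 < m" and \<sigma>: "0 < \<sigma>" and f: "good_profile_with_interface m \<sigma> f"
  shows "\<not> P2 m f"
proof
  assume P2: "P2 m f"
  obtain \<eta> where gp: "good_profile_with_interface_at m \<sigma> \<eta> f"
    using f unfolding good_profile_with_interface_def by blast
  then have \<eta>: "0 < \<eta>" "f \<eta> = 0" "((\<lambda>\<xi>. f \<xi> powr m) has_real_derivative 0) (at \<eta>)"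
    and sol: "solution_on m \<sigma> {0..} f"
    unfolding good_profile_with_interface_at_def good_profile_def by blast+
  obtain \<delta> where \<delta>: "0 < \<delta>" "\<delta> \<le> \<eta>" "\<And>\<xi>. \<xi> \<in> {\<eta> - \<delta><..<\<eta>} \<Longrightarrow> 0 < f \<xi>"
    using gp unfolding good_profile_with_interface_at_def by blast
  obtain g' g'' where sol': "\<forall>\<xi>\<in>{0..}. ((\<lambda>\<xi>. f \<xi> powr m) has_real_derivative g' \<xi>) (at \<xi> within {0..})"
    "\<forall>\<xi>\<in>{0..}. (g' has_real_derivative g'' \<xi>) (at \<xi> within {0..})"
    "\<forall>\<xi>\<in>{0..}. g'' \<xi> - 1 / (m - 1) * f \<xi> + \<xi> powr \<sigma> * f \<xi> powr m = 0"
    using sol unfolding solution_on_def C2_on_def by blast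
  have g': "((\<lambda>\<xi>. f \<xi> powr m) has_real_derivative g' \<xi>) (at \<xi> within {0..})"
    and g'': "(g' has_real_derivative g'' \<xi>) (at \<xi> within {0..})"
    and eq: "g'' \<xi> - 1 / (m - 1) * f \<xi> + \<xi> powr \<sigma> * f \<xi> powr m = 0" if "0 \<le> \<xi>" for \<xi>
    using bspec[OF sol'(1)] bspec[OF sol'(2)] bspec[OF sol'(3)] that by simp_all
  have nonneg: "0 \<le> f \<xi>" if "0 \<le> \<xi>" for \<xi> using sol that unfolding solution_on_def by simp
  have at: "at \<xi> within {0..} = at \<xi>" if "0 < \<xi>" for \<xi> :: real using that by (intro at_within_interior) auto
  have "f (\<eta> - \<delta> / 2) powr m = 0"
  proof (rule solution_vanishes_between_zeros[of "1 / m" "1 / (m - 1)" \<sigma> 0 \<eta> "\<lambda>\<xi>. f \<xi> powr m" g'])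
    show "((\<lambda>\<xi>. f \<xi> powr m) has_real_derivative g' \<xi>) (at \<xi>)" if "0 < \<xi>" "\<xi> < \<eta>" for \<xi>
      using g'[of \<xi>] at that by simp
    show "(g' has_real_derivative 1 / (m - 1) * (f \<xi> powr m) powr (1 / m) - \<xi> powr \<sigma> * f \<xi> powr m) (at \<xi>)"
      if "0 < \<xi>" "\<xi> < \<eta>" for \<xi>
    proof -
      have "g'' \<xi> = 1 / (m - 1) * (f \<xi> powr m) powr (1 / m) - \<xi> powr \<sigma> * f \<xi> powr m"
        using eq[of \<xi>] nonneg[of \<xi>] that m by (simp add: powr_powr)
      then show ?thesis using g''[of \<xi>] at that by simp
    qed
    have "continuous_on {0..} (\<lambda>\<xi>. f \<xi> powr m)" "continuous_on {0..} g'"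
      using g' g'' DERIV_continuous continuous_on_eq_continuous_within by (metis atLeast_iff)+
    then show "continuous_on {0..\<eta>} (\<lambda>\<xi>. f \<xi> powr m)" "continuous_on {0..\<eta>} g'"
      by (auto intro: continuous_on_subset)
    show "g' \<eta> = 0" using DERIV_unique[OF _ \<eta>(3)] g'[of \<eta>] at[of \<eta>] \<eta>(1) by simp
  qed (use m \<sigma> \<eta> \<delta> P2 in \<open>auto simp: P2_def\<close>)
  moreover have "0 < f (\<eta> - \<delta> / 2)" using \<delta> by simp
  ultimately show False by simp
qed

theorem theorem1p2:
  fixes m :: real
  assumes "m > 1"
  shows "\<forall>k::nat. k \<ge> 1 \<longrightarrow>
    (\<exists>\<delta>::real. \<delta> > 0 \<and> (\<forall>\<sigma>::real. 0 < \<sigma> \<and> \<sigma> < \<delta> \<longrightarrow>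
      (\<exists>f :: nat \<Rightarrow> real \<Rightarrow> real.
         (\<forall>i<k. good_profile_with_interface m \<sigma> (f i)) \<and>
         (\<forall>i<k. \<forall>j<k. i \<noteq> j \<longrightarrow> different_profiles (f i) (f j))) \<and>
      (\<forall>f. good_profile_with_interface m \<sigma> f \<longrightarrow> P1 f) \<and>
      \<not> (\<exists>f. good_profile_with_interface m \<sigma> f \<and> P2 m f)))"
proof (intro allI impI)
  fix k :: nat
  have p: "0 < 1 / m" "1 / m < 1" using assms by auto
  obtain \<delta> where \<delta>: "0 < \<delta>"
    "\<And>\<sigma> j. 0 < \<sigma> \<Longrightarrow> \<sigma> < \<delta> \<Longrightarrow> 1 \<le> j \<Longrightarrow> j \<le> k \<Longrightarrow> \<exists>\<eta> h v. interface_orbit (1 / m) \<sigma> \<eta> h v \<and>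
       integral {0..1} (\<lambda>t. angular_rate (1 / m) \<sigma> \<eta> t (h t) (v t)) = - real j * pi"
    using ex_interface_orbits[OF p] by blast
  show "\<exists>\<delta>::real. \<delta> > 0 \<and> (\<forall>\<sigma>::real. 0 < \<sigma> \<and> \<sigma> < \<delta> \<longrightarrow>
      (\<exists>f :: nat \<Rightarrow> real \<Rightarrow> real.
         (\<forall>i<k. good_profile_with_interface m \<sigma> (f i)) \<and>
         (\<forall>i<k. \<forall>j<k. i \<noteq> j \<longrightarrow> different_profiles (f i) (f j))) \<and>
      (\<forall>f. good_profile_with_interface m \<sigma> f \<longrightarrow> P1 f) \<and>
      \<not> (\<exists>f. good_profile_with_interface m \<sigma> f \<and> P2 m f))"
  proof (intro exI[of _ \<delta>] conjI allI impI \<delta>(1))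
    fix \<sigma> :: real assume \<sigma>: "0 < \<sigma> \<and> \<sigma> < \<delta>"
    have no_P2: "\<not> P2 m f" if "good_profile_with_interface m \<sigma> f" for f
      using interface_not_P2[OF assms _ that] \<sigma> by blast
    then show "\<not> (\<exists>f. good_profile_with_interface m \<sigma> f \<and> P2 m f)" by blast
    show "P1 f" if "good_profile_with_interface m \<sigma> f" for f
      using no_P2[OF that] that
      by (auto simp: good_profile_with_interface_def good_profile_with_interface_at_def good_profile_def)
    \<comment> \<open>The shift to \<open>Suc i\<close> leaves out the angle 0, for which no orbit
      was constructed.\<close>
    have "\<forall>i. \<exists>\<eta> h v. i < k \<longrightarrow> interface_orbit (1 / m) \<sigma> \<eta> h v \<and>
       integral {0..1} (\<lambda>t. angular_rate (1 / m) \<sigma> \<eta> t (h t) (v t)) = - real (Suc i) * pi"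
      using \<delta>(2)[of \<sigma>] \<sigma> by (metis Suc_leI le_add1 plus_1_eq_Suc)
    then obtain \<eta> h v where orbit: "\<And>i. i < k \<Longrightarrow> interface_orbit (1 / m) \<sigma> (\<eta> i) (h i) (v i)"
      "\<And>i. i < k \<Longrightarrow> integral {0..1} (\<lambda>t. angular_rate (1 / m) \<sigma> (\<eta> i) t (h i t) (v i t)) = - real (Suc i) * pi"
      by metis
    show "\<exists>f :: nat \<Rightarrow> real \<Rightarrow> real. (\<forall>i<k. good_profile_with_interface m \<sigma> (f i)) \<and>
         (\<forall>i<k. \<forall>j<k. i \<noteq> j \<longrightarrow> different_profiles (f i) (f j))"
    proof (intro exI[of _ "\<lambda>i. profile m (\<eta> i) (h i)"] conjI allI impI)
      fix i assume i: "i < k"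
      show "good_profile_with_interface m \<sigma> (profile m (\<eta> i) (h i))"
        unfolding good_profile_with_interface_def using profile_good[OF assms _ orbit(1)[OF i]] \<sigma> by blast
      fix j assume j: "j < k" "i \<noteq> j"
      show "different_profiles (profile m (\<eta> i) (h i)) (profile m (\<eta> j) (h j))"
        by (rule profiles_different[OF assms _ orbit(1)[OF i] orbit(1)[OF j(1)]])
           (use \<sigma> orbit(2)[OF i] orbit(2)[OF j(1)] j(2) in auto)
    qed
  qed
qed

end
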